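(* Let $S=(S_t)_{t\ge 0}$ be a subordinator with zero drift and Laplace exponent $\phi$, let $H(\lambda)=\phi(\lambda)-\lambda\phi'(\lambda)$, and let $X=(X_t)_{t\ge 0}$ be the corresponding subordinate Brownian motion in $\mathbb{R}^d$ ($d\ge1$) with transition density $p(t,x,y)=p(t,y-x)$. (i) If $\phi$ satisfies (L) with constants $\gamma,\lambda_L,C_L$, then there exists a constant $\kappa\in(0,1)$ such that $$p(t,x)\asymp \phi^{-1}(t^{-1})^{d/2}$$ for all $0<t<\kappa\phi(\lambda_L)^{-1}$ and $x\in\mathbb{R}^d$ satisfying $t\phi(|x|^{-2})\ge1$. (ii) If $H$ satisfies (L) with constants $\gamma,\lambda_L,C_L$ and (U) with constants $\delta,\lambda_U,C_U$ where $\delta<2$, then there exist constants $\kappa,\eta,\theta\in(0,1)$, $C\ge1$ and $a_L,a_U>0$ such that for all $0<t<\kappa\phi(\lambda_L)^{-1}$ and $x\in\mathbb{R}^d$ satisfying $|x|<\theta\lambda_L^{-1/2}\wedge\eta\lambda_U^{-1/2}$ and $t\phi(|x|^{-2})\le1$, $$p(t,x)\le C\left(t|x|^{-d}H(|x|^{-2})\vee \phi^{-1}(t^{-1})^{d/2}e^{-a_U|x|^2\phi^{-1}(t^{-1})}\right)$$ and $$p(t,x)\ge C^{-1}\left(t|x|^{-d}H(|x|^{-2})\vee \phi^{-1}(t^{-1})^{d/2}e^{-a_L|x|^2\phi^{-1}(t^{-1})}\right).$$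
   Context: A subordinator $S=(S_t)_{t\ge0}$ is an increasing Lévy process with values in $[0,\infty)$, started at $0$. Its Laplace exponent $\phi$ is defined by $\mathbb{E}e^{-\lambda S_t}=e^{-t\phi(\lambda)}$, $\lambda>0$, and $\phi(\lambda)=b\lambda+\int_{(0,\infty)}(1-e^{-\lambda s})\mu(ds)$, where $b\ge0$ is the drift and $\mu$ is the Lévy measure, a measure on $(0,\infty)$ with $\int_{(0,\infty)}(1\wedge s)\mu(ds)<\infty$. The corresponding subordinate Brownian motion is $X_t=B_{S_t}$, where $B$ is a Brownian motion in $\mathbb{R}^d$ independent of $S$, normalized so that $\mathbb{E}e^{i\xi\cdot B_t}=e^{-t|\xi|^2}$; its transition density is $p(t,x)=\int_{(0,\infty)}(4\pi s)^{-d/2}e^{-|x|^2/(4s)}\,\mathbb{P}(S_t\in ds)$. Scaling conditions for $f:(0,\infty)\to(0,\infty)$. (L): there exist $\gamma>0$, $\lambda_L\ge0$, $C_L>0$ such that $f(\lambda x)/f(\lambda)\ge C_Lx^\gamma$ for all $\lambda>\lambda_L$, $x\ge1$. (U): there exist $\delta>0$, $\lambda_U\ge0$, $C_U>0$ such that $f(\lambda x)/f(\lambda)\le C_Ux^\delta$ for all $\lambda>\lambda_U$, $x\ge1$. $\phi^{-1}$ is the inverse function of $\phi$; $a\wedge b=\min\{a,b\}$, $a\vee b=\max\{a,b\}$. $f\asymp g$ on a set means there are constants $c_1,c_2>0$ with $c_1f\le g\le c_2f$ on that set (constants not depending on $t,x$). Conventions: $\phi(0)=0$, $0^{-1}=+\infty$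 (so $0^{-1/2}=+\infty$, and $\phi(|x|^{-2})=\lim_{\lambda\to\infty}\phi(\lambda)=+\infty$ for $x=0$). *)

theory Defs
  imports "HOL-Probability.Probability"
begin

definition levy_process :: "'w measure \<Rightarrow> (real \<Rightarrow> 'w \<Rightarrow> 'a::euclidean_space) \<Rightarrow> bool" where
  "levy_process M X \<longleftrightarrow>
     prob_space M \<and>
     (\<forall>t\<ge>0. X t \<in> borel_measurable M) \<and>
     (AE \<omega> in M. X 0 \<omega> = 0) \<and>
     (\<forall>(n::nat) (\<tau>::nat \<Rightarrow> real). 0 \<le> \<tau> 0 \<and> mono \<tau> \<longrightarrow>
        prob_space.indep_vars M (\<lambda>_. borel) (\<lambda>i \<omega>. X (\<tau> (Suc i)) \<omega> - X (\<tau> i) \<omega>) {..<n}) \<and>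
     (\<forall>s\<ge>0. \<forall>h\<ge>0. distr M borel (\<lambda>\<omega>. X (s + h) \<omega> - X s \<omega>) = distr M borel (X h)) \<and>
     (AE \<omega> in M. \<forall>t\<ge>0.
        ((\<lambda>s. X s \<omega>) \<longlongrightarrow> X t \<omega>) (at_right t) \<and>
        (t > 0 \<longrightarrow> (\<exists>l. ((\<lambda>s. X s \<omega>) \<longlongrightarrow> l) (at_left t))))"

definition subordinator :: "'w measure \<Rightarrow> (real \<Rightarrow> 'w \<Rightarrow> real) \<Rightarrow> bool" where
  "subordinator M S \<longleftrightarrow>
     levy_process M S \<and>
     (\<forall>t\<ge>0. \<forall>\<omega>\<in>space M. 0 \<le> S t \<omega>) \<and>
     (AE \<omega> in M. mono_on {0..} (\<lambda>t. S t \<omega>))"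

text \<open>The relation determines \<open>\<phi>\<close> on \<open>(0,\<infinity>)\<close> only; the value at \<open>0\<close> is fixed by convention,
  and negative arguments are irrelevant.\<close>

definition laplace_exponent :: "'w measure \<Rightarrow> (real \<Rightarrow> 'w \<Rightarrow> real) \<Rightarrow> (real \<Rightarrow> real) \<Rightarrow> bool" where
  "laplace_exponent M S \<phi> \<longleftrightarrow>
     \<phi> 0 = 0 \<and>
     (\<forall>t\<ge>0. \<forall>lam>0. (\<integral>\<omega>. exp (- lam * S t \<omega>) \<partial>M) = exp (- t * \<phi> lam))"

definition levy_measure :: "real measure \<Rightarrow> bool" where
  "levy_measure \<mu> \<longleftrightarrow>
     sets \<mu> = sets (restrict_space borel {0<..}) \<and>
     (\<integral>\<^sup>+ s. ennreal (min 1 s) \<partial>\<mu>) < \<infinity>"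

definition has_drift_and_levy_measure :: "(real \<Rightarrow> real) \<Rightarrow> real \<Rightarrow> real measure \<Rightarrow> bool" where
  "has_drift_and_levy_measure \<phi> b \<mu> \<longleftrightarrow>
     b \<ge> 0 \<and> levy_measure \<mu> \<and>
     (\<forall>lam>0. \<phi> lam = b * lam + (\<integral>s. 1 - exp (- lam * s) \<partial>\<mu>))"

text \<open>The clock is normalised so that \<open>B t\<close> has covariance \<open>2t\<close> times the identity.\<close>

definition brownian_motion :: "'w measure \<Rightarrow> (real \<Rightarrow> 'w \<Rightarrow> real ^ 'd) \<Rightarrow> bool" where
  "brownian_motion M B \<longleftrightarrow>
     levy_process M B \<and>
     (AE \<omega> in M. continuous_on {0..} (\<lambda>t. B t \<omega>)) \<and>
     (\<forall>t\<ge>0. \<forall>\<xi>. (\<integral>\<omega>. iexp (\<xi> \<bullet> B t \<omega>) \<partial>M) = complex_of_real (exp (- t * (norm \<xi>)\<^sup>2)))"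

definition process_events :: "'w measure \<Rightarrow> (real \<Rightarrow> 'w \<Rightarrow> 'a::topological_space) \<Rightarrow> 'w set set" where
  "process_events M X =
     sets (vimage_algebra (space M) (\<lambda>\<omega>. \<lambda>t\<in>{0..}. X t \<omega>) (PiM {0..} (\<lambda>_. borel)))"

text \<open>Independence is stated with generated sigma-algebras because \<open>indep_var\<close> requires both
  random variables to take values in the same type.\<close>

definition subordinate_brownian_motion ::
  "'w measure \<Rightarrow> (real \<Rightarrow> 'w \<Rightarrow> real ^ 'd) \<Rightarrow> (real \<Rightarrow> 'w \<Rightarrow> real) \<Rightarrow> (real \<Rightarrow> 'w \<Rightarrow> real ^ 'd) \<Rightarrow> bool" where
  "subordinate_brownian_motion M B S X \<longleftrightarrow>
     brownian_motion M B \<and> subordinator M S \<and>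
     prob_space.indep_set M (process_events M B) (process_events M S) \<and>
     (\<forall>t\<ge>0. \<forall>\<omega>\<in>space M. X t \<omega> = B (S t \<omega>) \<omega>)"

text \<open>The transition density of \<open>X\<close>, given by mixing the Gaussian kernel over the law of \<open>S t\<close>.
  It takes extended values since the integral may diverge, for instance at \<open>x = 0\<close>.\<close>

definition transition_density ::
  "'w measure \<Rightarrow> (real \<Rightarrow> 'w \<Rightarrow> real) \<Rightarrow> real \<Rightarrow> real ^ 'd \<Rightarrow> ennreal" where
  "transition_density M S t x =
     (\<integral>\<^sup>+ s\<in>{0<..}. ennreal ((4 * pi * s) powr (- real CARD('d) / 2) * exp (- (norm x)\<^sup>2 / (4 * s)))
        \<partial>(distr M borel (S t)))"

definition scaling_L :: "(real \<Rightarrow> real) \<Rightarrow> real \<Rightarrow> real \<Rightarrow> real \<Rightarrow> bool" where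
  "scaling_L f \<gamma> lamL C\<^sub>L \<longleftrightarrow>
     (\<forall>lam>0. f lam > 0) \<and> \<gamma> > 0 \<and> lamL \<ge> 0 \<and> C\<^sub>L > 0 \<and>
     (\<forall>lam>lamL. \<forall>x\<ge>1. f (lam * x) / f lam \<ge> C\<^sub>L * x powr \<gamma>)"

definition scaling_U :: "(real \<Rightarrow> real) \<Rightarrow> real \<Rightarrow> real \<Rightarrow> real \<Rightarrow> bool" where
  "scaling_U f \<delta> lamU C\<^sub>U \<longleftrightarrow>
     (\<forall>lam>0. f lam > 0) \<and> \<delta> > 0 \<and> lamU \<ge> 0 \<and> C\<^sub>U > 0 \<and>
     (\<forall>lam>lamU. \<forall>x\<ge>1. f (lam * x) / f lam \<le> C\<^sub>U * x powr \<delta>)"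

definition H_of :: "(real \<Rightarrow> real) \<Rightarrow> real \<Rightarrow> real" where
  "H_of \<phi> lam = \<phi> lam - lam * deriv \<phi> lam"

definition phi_inv :: "(real \<Rightarrow> real) \<Rightarrow> real \<Rightarrow> real" where
  "phi_inv \<phi> = inv_into {0<..} \<phi>"

text \<open>The value of \<open>\<phi>\<close> at \<open>|x|\<^sup>-\<^sup>2\<close>, read as \<open>\<infinity>\<close> (the limit of \<open>\<phi>\<close> at infinity under the scaling
  condition) when \<open>x = 0\<close>.\<close>

definition phi_at_inv_norm_sq :: "(real \<Rightarrow> real) \<Rightarrow> real ^ 'd \<Rightarrow> ereal" where
  "phi_at_inv_norm_sq \<phi> x = (if x = 0 then \<infinity> else ereal (\<phi> (inverse ((norm x)\<^sup>2))))"

text \<open>In \<open>ereal\<close>, \<open>inverse 0 = \<infinity>\<close>, so the next two bounds are vacuous when their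
  scale parameters vanish.\<close>

definition time_range :: "(real \<Rightarrow> real) \<Rightarrow> real \<Rightarrow> real \<Rightarrow> real \<Rightarrow> bool" where
  "time_range \<phi> \<kappa> lamL t \<longleftrightarrow> 0 < t \<and> ereal t < ereal \<kappa> * inverse (ereal (\<phi> lamL))"

definition space_range :: "real \<Rightarrow> real \<Rightarrow> real \<Rightarrow> real \<Rightarrow> real ^ 'd \<Rightarrow> bool" where
  "space_range \<theta> lamL \<eta> lamU x \<longleftrightarrow>
     ereal (norm x) < min (ereal \<theta> * inverse (ereal (sqrt lamL))) (ereal \<eta> * inverse (ereal (sqrt lamU)))"

definition comparable_on :: "'a set \<Rightarrow> ('a \<Rightarrow> ennreal) \<Rightarrow> ('a \<Rightarrow> ennreal) \<Rightarrow> bool" where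
  "comparable_on A f g \<longleftrightarrow>
     (\<exists>c\<^sub>1 c\<^sub>2 :: real. c\<^sub>1 > 0 \<and> c\<^sub>2 > 0 \<and>
        (\<forall>a\<in>A. ennreal c\<^sub>1 * f a \<le> g a \<and> g a \<le> ennreal c\<^sub>2 * f a))"

definition two_term_bound ::
  "(real \<Rightarrow> real) \<Rightarrow> real \<Rightarrow> real \<Rightarrow> real ^ 'd \<Rightarrow> real" where
  "two_term_bound \<phi> a t x =
     max (t * norm x powr (- real CARD('d)) * H_of \<phi> (inverse ((norm x)\<^sup>2)))
         (phi_inv \<phi> (inverse t) powr (real CARD('d) / 2) *
            exp (- a * (norm x)\<^sup>2 * phi_inv \<phi> (inverse t)))"

end

theory Submission
  imports Defs "HOL-Real_Asymp.Real_Asymp"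
begin

text \<open>Only the law of \<open>S\<^sub>t\<close> matters. With \<open>r = \<phi>\<^sup>-\<^sup>1(1/t)\<close>, scaling (L) puts mass at
  least \<open>1/2\<close> of \<open>S\<^sub>t\<close> at distance of order \<open>1/r\<close> from the origin and makes \<open>E S\<^sub>t\<^sup>-\<^sup>d\<^sup>/\<^sup>2\<close> of order
  \<open>r\<^sup>d\<^sup>/\<^sup>2\<close>; this gives the near-diagonal estimate and the Gaussian term. The jump term comes from
  \<open>P(S\<^sub>t \<ge> v) \<asymp> t H(1/v)\<close> for \<open>v\<close> a large multiple of \<open>1/r\<close>. No Levy-Ito decomposition is needed for
  this: cut \<open>S\<^sub>t\<close> into \<open>n\<close> independent increments, compare the tail of each increment with
  \<open>E h(\<lambda>S\<^sub>t\<^sub>/\<^sub>n) \<approx> (t/n) H(\<lambda>)\<close>, where \<open>h(y) = 1 - e\<^sup>-\<^sup>y - y e\<^sup>-\<^sup>y\<close> behaves like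
  \<open>min(1,y\<^sup>2)\<close>, and let \<open>n \<rightarrow> \<infinity>\<close>.\<close>

section \<open>Elementary inequalities\<close>

text \<open>The obstacle is that H may be much smaller than \<phi>: comparing P(S_t \<ge> v) with
  E(1 - e^(-S_t/v)) gives only t \<phi>(1/v), too weak for the jump term. The function h is forced
  by the Laplace identity: differentiating it in \<lambda> yields E h(\<lambda> S_t) = h(t
  \<phi>(\<lambda>)) + t H(\<lambda>) e^(-t \<phi>(\<lambda>)), where the term free of H is of order
  t^2. Over n pieces of length t/n such errors add up to order 1/n. In terms of the Levy measure
  H(\<lambda>) is the integral of h(\<lambda> s), and a drift would cancel in it. Scaling of H
  therefore controls \<phi> only because \<phi>(\<lambda>)/\<lambda> tends to 0, which is where the
  absence of drift is decisive. The ranges of t and x are read through r: with \<kappa> = 1/b one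
  gets r > b \<open>lamL\<close>, so scaling is available at r/b as well as at r, and comparing t
  \<phi>(|x|^-2) with 1 amounts to comparing 1 with |x|^2 r.\<close>

definition hfun :: "real \<Rightarrow> real" where
  "hfun y = 1 - exp (- y) - y * exp (- y)"

lemma hfun_has_derivative [derivative_intros]:
  assumes "(f has_real_derivative f') (at x within A)"
  shows "((\<lambda>x. hfun (f x)) has_real_derivative f x * exp (- f x) * f') (at x within A)"
  unfolding hfun_def by (auto intro!: derivative_eq_intros assms simp: algebra_simps)

lemma hfun_measurable [measurable]: "hfun \<in> borel_measurable borel"
  unfolding hfun_def by measurable

text \<open>Most inequalities of this section apply this to a difference that vanishes at 0 and
  whose derivative factors into terms of visible sign.\<close>

lemma nonneg_from_derivative:
  fixes f :: "real \<Rightarrow> real"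
  assumes "a \<le> b" "0 \<le> f a"
    and "\<And>x. a \<le> x \<Longrightarrow> x \<le> b \<Longrightarrow> (f has_real_derivative f' x) (at x)"
    and "\<And>x. a \<le> x \<Longrightarrow> x \<le> b \<Longrightarrow> 0 \<le> f' x"
  shows "0 \<le> f b"
  using DERIV_nonneg_imp_nondecreasing[of a b f] assms by fastforce

lemma hfun_0 [simp]: "hfun 0 = 0" by (simp add: hfun_def)

lemma hfun_mono: "0 \<le> x \<Longrightarrow> x \<le> y \<Longrightarrow> hfun x \<le> hfun y"
  by (rule DERIV_nonneg_imp_nondecreasing) (auto intro!: exI derivative_eq_intros)

lemma hfun_nonneg: "0 \<le> y \<Longrightarrow> 0 \<le> hfun y"
  using hfun_mono[of 0 y] by simp

lemma hfun_le_1: "0 \<le> y \<Longrightarrow> hfun y \<le> 1"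
  unfolding hfun_def using mult_nonneg_nonneg[of y "exp (- y)"] exp_gt_zero[of "- y"] by linarith

text \<open>The derivative of the difference is c^2 y (e^(-y) - e^(-cy)). Passed to the limit, this
  is the universal growth bound H(c\<lambda>) \<le> c^2 H(\<lambda>) of
  \<open>H_scale\<close>.\<close>

lemma hfun_scale:
  assumes "1 \<le> c" "0 \<le> y"
  shows "hfun (c * y) \<le> c\<^sup>2 * hfun y"
proof -
  have "0 \<le> c\<^sup>2 * hfun y - hfun (c * y)"
  proof (rule nonneg_from_derivative[OF assms(2), where f = "\<lambda>y. c\<^sup>2 * hfun y - hfun (c * y)"
        and f' = "\<lambda>y. c\<^sup>2 * y * (exp (- y) - exp (- (c * y)))"])
    show "((\<lambda>y. c\<^sup>2 * hfun y - hfun (c * y)) has_real_derivative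
        c\<^sup>2 * x * (exp (- x) - exp (- (c * x)))) (at x)" for x
      by (auto intro!: derivative_eq_intros simp: algebra_simps power2_eq_square)
    show "0 \<le> c\<^sup>2 * x * (exp (- x) - exp (- (c * x)))" if "0 \<le> x" for x
      using that assms mult_right_mono[of 1 c x] by auto
  qed simp
  then show ?thesis by simp
qed

lemma hfun_le_square: "0 \<le> y \<Longrightarrow> hfun y \<le> y\<^sup>2 / 2"
proof -
  assume y: "0 \<le> y"
  have "0 \<le> y\<^sup>2 / 2 - hfun y"
  proof (rule nonneg_from_derivative[OF y, where f = "\<lambda>y. y\<^sup>2 / 2 - hfun y"
        and f' = "\<lambda>y. y - y * exp (- y)"])
    show "((\<lambda>y. y\<^sup>2 / 2 - hfun y) has_real_derivative x - x * exp (- x)) (at x)" for x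
      by (auto intro!: derivative_eq_intros)
  qed (auto simp: mult_left_le)
  then show ?thesis by simp
qed

lemma exp_minus_ge_third: "x \<le> (1::real) \<Longrightarrow> 1 \<le> 3 * exp (- x)"
  using exp_le exp_le_cancel_iff[of x 1] by (simp add: exp_minus field_simps del: exp_le_cancel_iff)

text \<open>The constant 6 is what makes the derivative 2y(3e^(-y) - 1) nonnegative on [0,1],
  because e \<le> 3. With \<open>hfun_le_square\<close>, \<open>hfun_le_1\<close> and
  \<open>one_le_hfun\<close> it gives the two-sided comparison of h with min(1, y^2).\<close>

lemma square_le_hfun:
  assumes "0 \<le> y" "y \<le> 1"
  shows "y\<^sup>2 \<le> 6 * hfun y"
proof -
  have "0 \<le> 6 * hfun y - y\<^sup>2"
  proof (rule nonneg_from_derivative[OF assms(1), where f = "\<lambda>y. 6 * hfun y - y\<^sup>2"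
        and f' = "\<lambda>y. 2 * y * (3 * exp (- y) - 1)"])
    show "((\<lambda>y. 6 * hfun y - y\<^sup>2) has_real_derivative 2 * x * (3 * exp (- x) - 1)) (at x)" for x
      by (auto intro!: derivative_eq_intros simp: algebra_simps)
    show "0 \<le> 2 * x * (3 * exp (- x) - 1)" if "0 \<le> x" "x \<le> y" for x
      using that assms exp_minus_ge_third[of x] by auto
  qed simp
  then show ?thesis by simp
qed

lemma one_le_hfun: "1 \<le> y \<Longrightarrow> 1 \<le> 6 * hfun y"
  using square_le_hfun[of 1] hfun_mono[of 1 y] by simp

lemma le_one_minus_exp:
  assumes "0 \<le> y" "y \<le> (1::real)"
  shows "y \<le> 3 * (1 - exp (- y))"
proof -
  have "0 \<le> 3 * (1 - exp (- y)) - y"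
  proof (rule nonneg_from_derivative[OF assms(1), where f = "\<lambda>y. 3 * (1 - exp (- y)) - y"
        and f' = "\<lambda>y. 3 * exp (- y) - 1"])
    show "((\<lambda>y. 3 * (1 - exp (- y)) - y) has_real_derivative 3 * exp (- x) - 1) (at x)" for x
      by (auto intro!: derivative_eq_intros simp: algebra_simps)
    show "0 \<le> 3 * exp (- x) - 1" if "0 \<le> x" "x \<le> y" for x
      using that assms exp_minus_ge_third[of x] by auto
  qed simp
  then show ?thesis by simp
qed

lemma one_le_one_minus_exp: "1 \<le> y \<Longrightarrow> 1 \<le> 2 * (1 - exp (- y))" for y :: real
proof -
  assume "1 \<le> y"
  then have "2 \<le> exp y" using exp_ge_add_one_self[of y] by linarith
  then show ?thesis by (simp add: exp_minus field_simps)
qed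

lemma one_minus_exp_scale:
  fixes c y :: real
  assumes "1 \<le> c" "0 \<le> y"
  shows "1 - exp (- (c * y)) \<le> c * (1 - exp (- y))"
proof -
  have "0 \<le> c * (1 - exp (- y)) - (1 - exp (- (c * y)))"
  proof (rule nonneg_from_derivative[OF assms(2),
        where f = "\<lambda>y. c * (1 - exp (- y)) - (1 - exp (- (c * y)))"
        and f' = "\<lambda>y. c * (exp (- y) - exp (- (c * y)))"])
    show "((\<lambda>y. c * (1 - exp (- y)) - (1 - exp (- (c * y)))) has_real_derivative
        c * (exp (- x) - exp (- (c * x)))) (at x)" for x
      by (auto intro!: derivative_eq_intros simp: algebra_simps)
    show "0 \<le> c * (exp (- x) - exp (- (c * x)))" if "0 \<le> x" for x
      using that assms mult_right_mono[of 1 c x] by auto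
  qed simp
  then show ?thesis by simp
qed

section \<open>Exponential remainders, Chernoff weights and dyadic levels\<close>

lemma exp_remainder_nonneg_arg:
  fixes z :: real
  assumes "0 \<le> z"
  shows "exp z \<le> 1 + z + z\<^sup>2 / 2 * exp z"
proof -
  have "0 \<le> 1 + z + z\<^sup>2 / 2 * exp z - exp z"
  proof (rule nonneg_from_derivative[OF assms, where f = "\<lambda>z. 1 + z + z\<^sup>2 / 2 * exp z - exp z"
        and f' = "\<lambda>z. exp z * (exp (- z) + z + z\<^sup>2 / 2 - 1)"])
    show "((\<lambda>z. 1 + z + z\<^sup>2 / 2 * exp z - exp z) has_real_derivative
        exp x * (exp (- x) + x + x\<^sup>2 / 2 - 1)) (at x)" for x
      by (auto intro!: derivative_eq_intros simp: algebra_simps exp_minus)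
    show "0 \<le> exp x * (exp (- x) + x + x\<^sup>2 / 2 - 1)" for x :: real
    proof -
      have "0 \<le> exp (- x) + x + x\<^sup>2 / 2 - 1"
        using exp_ge_add_one_self[of "- x"] zero_le_power2[of x] by linarith
      then show ?thesis by simp
    qed
  qed simp
  then show ?thesis by simp
qed

lemma abs_exp_remainder: "\<bar>exp z - 1 - z\<bar> \<le> z\<^sup>2 / 2 * exp \<bar>z\<bar>" for z :: real
proof (cases "0 \<le> z")
  case True
  then have "\<bar>exp z - 1 - z\<bar> = exp z - 1 - z" "\<bar>z\<bar> = z"
    using exp_ge_add_one_self[of z] by linarith+
  then show ?thesis using exp_remainder_nonneg_arg[OF True] by linarith
next
  case False
  define w where "w = - z"
  have w: "0 \<le> w" using False by (simp add: w_def)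
  have "0 \<le> w\<^sup>2 / 2 - (exp (- w) - 1 + w)"
  proof (rule nonneg_from_derivative[OF w, where f = "\<lambda>w. w\<^sup>2 / 2 - (exp (- w) - 1 + w)"
        and f' = "\<lambda>w. exp (- w) - 1 + w"])
    show "((\<lambda>w. w\<^sup>2 / 2 - (exp (- w) - 1 + w)) has_real_derivative exp (- x) - 1 + x) (at x)" for x
      by (auto intro!: derivative_eq_intros simp: algebra_simps)
    show "0 \<le> exp (- x) - 1 + x" for x :: real
      using exp_ge_add_one_self[of "- x"] by linarith
  qed simp
  then have "exp z - 1 - z \<le> z\<^sup>2 / 2" by (simp add: w_def)
  then have "\<bar>exp z - 1 - z\<bar> \<le> z\<^sup>2 / 2"
    using exp_ge_add_one_self[of z] by linarith
  also have "\<dots> \<le> z\<^sup>2 / 2 * exp \<bar>z\<bar>" by (simp add: mult_le_cancel_left1)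
  finally show ?thesis .
qed

lemma square_half_le_exp: "0 \<le> z \<Longrightarrow> z\<^sup>2 / 2 \<le> exp z" for z :: real
  using exp_lower_Taylor_quadratic[of z] by linarith

text \<open>Serves the Chernoff bound in \<open>upper_tail\<close>. In the Taylor remainder both
  L^2/2 and e^(Ly) are at most e^L, so the coefficient of y^2 becomes the pure exponential e^(2L),
  which the choice of L there turns into an exact reciprocal.\<close>

lemma exp_mult_le_quadratic:
  fixes L y :: real
  assumes "0 \<le> L" "0 \<le> y" "y \<le> 1"
  shows "exp (L * y) \<le> 1 + L * y + y\<^sup>2 * exp (2 * L)"
proof -
  have "exp (L * y) \<le> 1 + L * y + (L * y)\<^sup>2 / 2 * exp (L * y)"
    using assms by (intro exp_remainder_nonneg_arg) auto
  also have "(L * y)\<^sup>2 / 2 * exp (L * y) = y\<^sup>2 * (L\<^sup>2 / 2 * exp (L * y))"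
    by (simp add: power_mult_distrib)
  also have "\<dots> \<le> y\<^sup>2 * (exp L * exp L)"
    using assms square_half_le_exp[of L] by (intro mult_left_mono mult_mono) (auto simp: mult_left_le)
  also have "exp L * exp L = exp (2 * L)" by (simp flip: exp_add)
  finally show ?thesis by simp
qed

text \<open>The function y^m e^(-Cy) is largest at y = m/C; the factor e^(-m) of its maximum is
  dropped.\<close>

lemma powr_le_exp:
  fixes m C y :: real
  assumes "0 < m" "0 < C" "0 < y"
  shows "y powr m \<le> (m / C) powr m * exp (C * y)"
proof -
  have "ln (C * y / m) \<le> C * y / m"
    using ln_le_minus_one[of "C * y / m"] assms by simp
  then have "m * ln y \<le> C * y + m * ln (m / C)"
    using assms by (simp add: ln_div ln_mult field_simps)
  then have "exp (m * ln y) \<le> exp (C * y + m * ln (m / C))" by simp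
  then show ?thesis using assms by (simp add: powr_def exp_add mult.commute)
qed

lemma dyadic_level:
  fixes s v :: real
  assumes "0 < s" "s \<le> v"
  obtains k :: nat where "v / 2 ^ Suc k < s" "s \<le> v / 2 ^ k"
proof -
  have "\<exists>k::nat. v / 2 ^ k < s"
  proof -
    obtain k where "v / s < 2 ^ k" using real_arch_pow[of 2 "v / s"] by auto
    then show ?thesis using assms by (auto simp: field_simps intro!: exI[of _ k])
  qed
  then have ex: "v / 2 ^ (LEAST k. v / 2 ^ k < s) < s" by (rule LeastI_ex)
  define k where "k = (LEAST k. v / 2 ^ k < s)"
  have ex': "v / 2 ^ k < s" using ex by (simp flip: k_def)
  then have "k \<noteq> 0" using assms by (intro notI) auto
  then obtain j where j: "k = Suc j" by (cases k) auto
  have "\<not> v / 2 ^ j < s" using not_less_Least[of j "\<lambda>k. v / 2 ^ k < s"] j by (simp flip: k_def)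
  then show ?thesis using that[of j] ex' j by auto
qed

text \<open>The derivative passes under the expectation by a uniform second-order bound: for |k|
  \<le> lam/2 a decay e^(-lam x/2) survives and absorbs x^2/2, so the Taylor error is at most 4
  k^2/lam^2 for every value x \<ge> 0 of X.\<close>

lemma (in prob_space) laplace_has_derivative:
  assumes [measurable]: "X \<in> borel_measurable M" and nn: "\<And>\<omega>. \<omega> \<in> space M \<Longrightarrow> 0 \<le> X \<omega>"
    and lam: "0 < lam"
  shows "((\<lambda>l. expectation (\<lambda>\<omega>. exp (- l * X \<omega>))) has_real_derivative
      - expectation (\<lambda>\<omega>. X \<omega> * exp (- lam * X \<omega>))) (at lam)"
    and "integrable M (\<lambda>\<omega>. X \<omega> * exp (- lam * X \<omega>))"
proof -
  have intexp: "integrable M (\<lambda>\<omega>. exp (- l * X \<omega>))" if "0 < l" for l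
    using nn that by (intro integrable_const_bound[where B = 1]) auto
  have xe: "x * exp (- lam * x) \<le> 1 / lam" if "0 \<le> x" for x
  proof -
    have "lam * x \<le> exp (lam * x)" using exp_ge_add_one_self[of "lam * x"] by linarith
    then show ?thesis using lam by (simp add: exp_minus field_simps)
  qed
  show int1: "integrable M (\<lambda>\<omega>. X \<omega> * exp (- lam * X \<omega>))"
    using nn xe by (intro integrable_const_bound[where B = "1 / lam"]) (auto simp: abs_mult)
  let ?L = "\<lambda>l. expectation (\<lambda>\<omega>. exp (- l * X \<omega>))"
  let ?D = "expectation (\<lambda>\<omega>. X \<omega> * exp (- lam * X \<omega>))"
  have pt: "\<bar>exp (- (lam + k) * x) - exp (- lam * x) + k * (x * exp (- lam * x))\<bar> \<le> k\<^sup>2 * (4 / lam\<^sup>2)"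
    if x: "0 \<le> x" and k: "\<bar>k\<bar> \<le> lam / 2" for x k
  proof -
    have "exp (- (lam + k) * x) - exp (- lam * x) + k * (x * exp (- lam * x))
        = exp (- lam * x) * (exp (- k * x) - 1 - (- k * x))"
      by (simp add: algebra_simps flip: exp_add)
    then have "\<bar>exp (- (lam + k) * x) - exp (- lam * x) + k * (x * exp (- lam * x))\<bar>
        \<le> exp (- lam * x) * ((- k * x)\<^sup>2 / 2 * exp \<bar>- k * x\<bar>)"
      using abs_exp_remainder[of "- k * x"] by (simp add: abs_mult)
    also have "\<dots> = k\<^sup>2 * (x\<^sup>2 / 2 * exp (- lam * x + \<bar>k\<bar> * x))"
      using x by (simp add: abs_mult power_mult_distrib mult.commute mult.left_commute flip: exp_add)
    also have "\<dots> \<le> k\<^sup>2 * (x\<^sup>2 / 2 * exp (- (lam / 2 * x)))"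
      using mult_right_mono[OF k x] by (intro mult_left_mono) auto
    also have "x\<^sup>2 / 2 * exp (- (lam / 2 * x)) \<le> 4 / lam\<^sup>2"
      using square_half_le_exp[of "lam / 2 * x"] x lam
      by (simp add: exp_minus field_simps power2_eq_square)
    finally show ?thesis by (simp add: mult_left_mono)
  qed
  have diff: "\<bar>(?L (lam + k) - ?L lam) / k - (- ?D)\<bar> \<le> \<bar>k\<bar> * (4 / lam\<^sup>2)"
    if k: "k \<noteq> 0" "\<bar>k\<bar> < lam / 2" for k
  proof -
    have int2: "integrable M (\<lambda>\<omega>. exp (- (lam + k) * X \<omega>))"
      by (rule intexp) (use k lam in linarith)
    have "?L (lam + k) - ?L lam + k * ?D = expectation (\<lambda>\<omega>. exp (- (lam + k) * X \<omega>)
        - exp (- lam * X \<omega>) + k * (X \<omega> * exp (- lam * X \<omega>)))"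
      using int1 int2 intexp[OF lam] by simp
    also have "\<bar>\<dots>\<bar> \<le> expectation (\<lambda>\<omega>. k\<^sup>2 * (4 / lam\<^sup>2))"
      using int1 int2 intexp[OF lam] pt nn k
      by (intro integral_abs_bound[THEN order_trans] integral_mono) auto
    finally have "\<bar>?L (lam + k) - ?L lam + k * ?D\<bar> \<le> k\<^sup>2 * (4 / lam\<^sup>2)" by (simp add: prob_space)
    then have "\<bar>(?L (lam + k) - ?L lam + k * ?D) / k\<bar> \<le> \<bar>k\<bar> * (4 / lam\<^sup>2)"
      using k by (simp add: abs_divide field_simps power2_eq_square)
    then show ?thesis using k by (simp add: field_simps)
  qed
  have "((\<lambda>k. (?L (lam + k) - ?L lam) / k - (- ?D)) \<longlongrightarrow> 0) (at 0)"
  proof (rule Lim_null_comparison)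
    show "\<forall>\<^sub>F k in at 0. norm ((?L (lam + k) - ?L lam) / k - (- ?D)) \<le> \<bar>k\<bar> * (4 / lam\<^sup>2)"
      unfolding eventually_at using lam diff
      by (intro exI[of _ "lam / 2"]) (auto simp: dist_real_def)
    show "((\<lambda>k. \<bar>k\<bar> * (4 / lam\<^sup>2)) \<longlongrightarrow> 0) (at 0)"
      by (intro tendsto_eq_intros) auto
  qed
  then show "(?L has_real_derivative - ?D) (at lam)"
    unfolding DERIV_def by (subst LIM_zero_iff[symmetric])
qed

section \<open>Independent increments of a subordinator\<close>

locale subordinator_laplace =
  fixes M :: "'w measure" and S :: "real \<Rightarrow> 'w \<Rightarrow> real" and \<phi> :: "real \<Rightarrow> real"
  assumes sub: "subordinator M S" and lap: "laplace_exponent M S \<phi>"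

sublocale subordinator_laplace \<subseteq> prob_space M
  using sub by (simp add: subordinator_def levy_process_def)

context subordinator_laplace
begin

abbreviation "H \<equiv> H_of \<phi>"

lemma S_measurable: "0 \<le> t \<Longrightarrow> S t \<in> borel_measurable M"
  using sub by (simp add: subordinator_def levy_process_def)

lemma S_nonneg: "0 \<le> t \<Longrightarrow> \<omega> \<in> space M \<Longrightarrow> 0 \<le> S t \<omega>"
  using sub by (simp add: subordinator_def)

lemma laplace: "0 \<le> t \<Longrightarrow> 0 < lam \<Longrightarrow> expectation (\<lambda>\<omega>. exp (- lam * S t \<omega>)) = exp (- t * \<phi> lam)"
  using lap by (simp add: laplace_exponent_def)

lemma integrable_bounded_image:
  fixes C :: real and f :: "real \<Rightarrow> real"
  assumes "0 \<le> t" and [measurable]: "f \<in> borel_measurable borel"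
    and "\<And>y. 0 \<le> y \<Longrightarrow> \<bar>f y\<bar> \<le> C"
  shows "integrable M (\<lambda>\<omega>. f (S t \<omega>))"
  using assms S_nonneg S_measurable[OF assms(1)]
  by (intro integrable_const_bound[where B = C]) auto

lemma expectation_indicator:
  assumes "0 \<le> t" and [measurable]: "A \<in> sets borel"
  shows "expectation (\<lambda>\<omega>. indicator A (S t \<omega>) :: real) = prob {\<omega> \<in> space M. S t \<omega> \<in> A}"
proof -
  note [measurable] = S_measurable[OF assms(1)]
  have "expectation (\<lambda>\<omega>. indicator A (S t \<omega>) :: real)
      = expectation (indicator {\<omega> \<in> space M. S t \<omega> \<in> A})"
    by (intro Bochner_Integration.integral_cong) (auto simp: indicator_def)
  then show ?thesis by simp
qed

text \<open>Collects what is used of the Levy property: the pieces over equal steps are independent,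
  distributed like the first one, and telescope to S t because S 0 = 0 almost surely. The bound on g
  is asked on the whole line since the pieces are nonnegative only almost surely.\<close>

lemma increments:
  fixes C :: real and g :: "real \<Rightarrow> real"
  assumes n: "0 < n" and t: "0 \<le> t" and [measurable]: "g \<in> borel_measurable borel"
    and bd: "\<And>y. \<bar>g y\<bar> \<le> C"
  defines "\<xi> \<equiv> \<lambda>i \<omega>. S (real (Suc i) * (t / n)) \<omega> - S (real i * (t / n)) \<omega>"
  shows "expectation (\<lambda>\<omega>. g (\<xi> i \<omega>)) = expectation (\<lambda>\<omega>. g (S (t / n) \<omega>))"
    and "integrable M (\<lambda>\<omega>. g (\<xi> i \<omega>))"
    and "expectation (\<lambda>\<omega>. \<Prod>i<n. g (\<xi> i \<omega>)) = expectation (\<lambda>\<omega>. g (S (t / n) \<omega>)) ^ n"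
    and "integrable M (\<lambda>\<omega>. \<Prod>i<n. g (\<xi> i \<omega>))"
    and "AE \<omega> in M. (\<Sum>i<n. \<xi> i \<omega>) = S t \<omega> \<and> (\<forall>i. 0 \<le> \<xi> i \<omega>)"
proof -
  define h where "h = t / n"
  have h: "0 \<le> h" using t by (simp add: h_def)
  have meas: "\<xi> i \<in> borel_measurable M" for i
    unfolding \<xi>_def using h by (auto intro!: borel_measurable_diff S_measurable simp flip: h_def)
  note [measurable] = meas S_measurable[OF h]
  have distr: "distr M borel (\<xi> i) = distr M borel (S h)" for i
  proof -
    have "\<forall>s\<ge>0. \<forall>h\<ge>0. distr M borel (\<lambda>\<omega>. S (s + h) \<omega> - S s \<omega>) = distr M borel (S h)"
      using sub by (simp add: subordinator_def levy_process_def)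
    from this[rule_format, of "real i * h" h] h show ?thesis
      by (simp add: \<xi>_def algebra_simps flip: h_def)
  qed
  have E: "expectation (\<lambda>\<omega>. g (\<xi> i \<omega>)) = expectation (\<lambda>\<omega>. g (S h \<omega>))" for i
  proof -
    have "expectation (\<lambda>\<omega>. g (\<xi> i \<omega>)) = integral\<^sup>L (distr M borel (\<xi> i)) g"
      by (simp add: integral_distr)
    also have "\<dots> = expectation (\<lambda>\<omega>. g (S h \<omega>))"
      unfolding distr by (simp add: integral_distr)
    finally show ?thesis .
  qed
  show "expectation (\<lambda>\<omega>. g (\<xi> i \<omega>)) = expectation (\<lambda>\<omega>. g (S (t / n) \<omega>))"
    using E h_def by simp
  have int: "integrable M (\<lambda>\<omega>. g (\<xi> i \<omega>))" for i
    using bd by (intro integrable_const_bound[where B = C]) auto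
  show "integrable M (\<lambda>\<omega>. g (\<xi> i \<omega>))" by (rule int)
  have "\<forall>(n::nat) (\<tau>::nat \<Rightarrow> real). 0 \<le> \<tau> 0 \<and> mono \<tau> \<longrightarrow>
        indep_vars (\<lambda>_. borel) (\<lambda>i \<omega>. S (\<tau> (Suc i)) \<omega> - S (\<tau> i) \<omega>) {..<n}"
    using sub by (simp add: subordinator_def levy_process_def)
  from this[rule_format, of "\<lambda>i. real i * h" n]
  have "indep_vars (\<lambda>_. borel) \<xi> {..<n}"
    using h by (simp add: \<xi>_def mono_def mult_right_mono flip: h_def)
  then have ind: "indep_vars (\<lambda>_. borel) (\<lambda>i \<omega>. g (\<xi> i \<omega>)) {..<n}"
    by (rule indep_vars_compose2) auto
  show "integrable M (\<lambda>\<omega>. \<Prod>i<n. g (\<xi> i \<omega>))"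
    by (rule indep_vars_integrable[OF _ ind int]) simp
  have "expectation (\<lambda>\<omega>. \<Prod>i<n. g (\<xi> i \<omega>)) = (\<Prod>i<n. expectation (\<lambda>\<omega>. g (\<xi> i \<omega>)))"
    by (rule indep_vars_lebesgue_integral[OF _ ind int]) simp
  then show "expectation (\<lambda>\<omega>. \<Prod>i<n. g (\<xi> i \<omega>)) = expectation (\<lambda>\<omega>. g (S (t / n) \<omega>)) ^ n"
    using E h_def by simp
  have "AE \<omega> in M. S 0 \<omega> = 0" "AE \<omega> in M. mono_on {0..} (\<lambda>t. S t \<omega>)"
    using sub by (auto simp: subordinator_def levy_process_def)
  then show "AE \<omega> in M. (\<Sum>i<n. \<xi> i \<omega>) = S t \<omega> \<and> (\<forall>i. 0 \<le> \<xi> i \<omega>)"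
  proof eventually_elim
    case (elim \<omega>)
    have "(\<Sum>i<n. \<xi> i \<omega>) = S (real n * h) \<omega> - S (real 0 * h) \<omega>"
      unfolding \<xi>_def h_def[symmetric] by (rule sum_lessThan_telescope)
    moreover have "real n * h = t" using n by (simp add: h_def)
    moreover have "S (real i * h) \<omega> \<le> S (real (Suc i) * h) \<omega>" for i
      using h by (intro mono_onD[OF elim(2)]) (auto intro!: mult_right_mono)
    ultimately show ?case using elim by (auto simp: \<xi>_def simp flip: h_def)
  qed
qed

text \<open>An increment exceeding \<open>w\<close> is handled by the union bound, the increments truncated at \<open>w\<close>
  by Chernoff's bound.\<close>

lemma prob_ge_le_increments:
  assumes n: "0 < n" and t: "0 \<le> t" and lam: "0 \<le> lam" and w: "0 \<le> w"
  shows "prob {\<omega> \<in> space M. v \<le> S t \<omega>} \<le> n * expectation (\<lambda>\<omega>. indicator {w<..} (S (t / n) \<omega>))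
     + exp (- lam * v) * expectation (\<lambda>\<omega>. exp (lam * (if S (t / n) \<omega> \<le> w then max 0 (S (t / n) \<omega>) else 0))) ^ n"
proof -
  define \<xi> where "\<xi> \<equiv> \<lambda>i \<omega>. S (real (Suc i) * (t / n)) \<omega> - S (real i * (t / n)) \<omega>"
  define f :: "real \<Rightarrow> real" where "f = indicator {w<..}"
  define g :: "real \<Rightarrow> real" where "g y = exp (lam * (if y \<le> w then max 0 y else 0))" for y
  have fm [measurable]: "f \<in> borel_measurable borel" and gm [measurable]: "g \<in> borel_measurable borel"
    unfolding f_def g_def by measurable
  have f_bd: "\<bar>f y\<bar> \<le> 1" for y by (simp add: f_def indicator_def)
  have g_bd: "\<bar>g y\<bar> \<le> exp (lam * w)" for y
    using lam w by (auto simp: g_def intro!: mult_left_mono)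
  note F = increments[OF n t fm f_bd]
  note G = increments[OF n t gm g_bd]
  note [measurable] = S_measurable[OF t]
  have Gint: "integrable M (\<lambda>\<omega>. \<Prod>i<n. g (\<xi> i \<omega>))"
    and Gprod: "expectation (\<lambda>\<omega>. \<Prod>i<n. g (\<xi> i \<omega>)) = expectation (\<lambda>\<omega>. g (S (t / n) \<omega>)) ^ n"
    using G(3,4) by (simp_all add: \<xi>_def)
  have Fint: "integrable M (\<lambda>\<omega>. f (\<xi> i \<omega>))"
    and Fexp: "expectation (\<lambda>\<omega>. f (\<xi> i \<omega>)) = expectation (\<lambda>\<omega>. f (S (t / n) \<omega>))" for i
    using F(1,2) by (simp_all add: \<xi>_def)
  have le: "AE \<omega> in M. indicator {v..} (S t \<omega>) \<le> (\<Sum>i<n. f (\<xi> i \<omega>)) + exp (- lam * v) * (\<Prod>i<n. g (\<xi> i \<omega>))"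
    using G(5)
  proof eventually_elim
    case (elim \<omega>)
    have el: "(\<Sum>i<n. \<xi> i \<omega>) = S t \<omega>" "\<And>i. 0 \<le> \<xi> i \<omega>"
      using elim by (simp_all add: \<xi>_def)
    have nn: "0 \<le> (\<Sum>i<n. f (\<xi> i \<omega>))" "0 \<le> exp (- lam * v) * (\<Prod>i<n. g (\<xi> i \<omega>))"
      by (auto intro!: sum_nonneg mult_nonneg_nonneg prod_nonneg simp: f_def g_def)
    show ?case
    proof (cases "\<exists>i<n. w < \<xi> i \<omega>")
      case True
      then obtain i where i: "i < n" "w < \<xi> i \<omega>" by blast
      then have "1 \<le> (\<Sum>i<n. f (\<xi> i \<omega>))"
        using member_le_sum[of i "{..<n}" "\<lambda>i. f (\<xi> i \<omega>)"] by (simp add: f_def)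
      then show ?thesis using nn by (simp add: indicator_def)
    next
      case False
      then have "\<xi> i \<omega> \<le> w" if "i < n" for i using that by (meson not_less)
      then have "(\<Prod>i<n. g (\<xi> i \<omega>)) = (\<Prod>i<n. exp (lam * \<xi> i \<omega>))"
        using el(2) by (intro prod.cong) (simp_all add: g_def)
      also have "\<dots> = exp (lam * S t \<omega>)"
        using el by (simp flip: exp_sum sum_distrib_left)
      finally have *: "exp (- lam * v) * (\<Prod>i<n. g (\<xi> i \<omega>)) = exp (lam * (S t \<omega> - v))"
        by (simp add: algebra_simps flip: exp_add)
      show ?thesis
      proof (cases "v \<le> S t \<omega>")
        case True
        then have "0 \<le> lam * (S t \<omega> - v)" using lam by simp
        then have "1 \<le> exp (- lam * v) * (\<Prod>i<n. g (\<xi> i \<omega>))" unfolding * by simp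
        then show ?thesis using nn by (simp add: indicator_def)
      qed (use nn in auto)
    qed
  qed
  have "prob {\<omega> \<in> space M. v \<le> S t \<omega>} = expectation (\<lambda>\<omega>. indicator {v..} (S t \<omega>))"
    using expectation_indicator[OF t] by simp
  also have "\<dots> \<le> expectation (\<lambda>\<omega>. (\<Sum>i<n. f (\<xi> i \<omega>)) + exp (- lam * v) * (\<Prod>i<n. g (\<xi> i \<omega>)))"
    using t by (intro integral_mono_AE le Bochner_Integration.integrable_add Bochner_Integration.integrable_sum integrable_mult_right Fint Gint
       integrable_bounded_image[where C = 1]) (auto simp: indicator_def)
  also have "\<dots> = (\<Sum>i<n. expectation (\<lambda>\<omega>. f (\<xi> i \<omega>))) + exp (- lam * v) * expectation (\<lambda>\<omega>. \<Prod>i<n. g (\<xi> i \<omega>))"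
    using Fint Gint by (simp add: Bochner_Integration.integral_sum)
  also have "\<dots> = n * expectation (\<lambda>\<omega>. f (S (t / n) \<omega>)) + exp (- lam * v) * expectation (\<lambda>\<omega>. g (S (t / n) \<omega>)) ^ n"
    unfolding Fexp Gprod by simp
  finally show ?thesis by (simp add: f_def g_def)
qed

text \<open>Since the pieces are nonnegative, a single piece of size at least w already forces S t
  \<ge> w. By independence no such piece occurs with probability (1 - q)^n, q being the probability
  for one piece.\<close>

lemma prob_ge_ge_increments:
  assumes n: "0 < n" and t: "0 \<le> t" 
  shows "1 - (1 - expectation (\<lambda>\<omega>. indicator {w..} (S (t / n) \<omega>))) ^ n \<le> prob {\<omega> \<in> space M. w \<le> S t \<omega>}"
proof -
  define \<xi> where "\<xi> \<equiv> \<lambda>i \<omega>. S (real (Suc i) * (t / n)) \<omega> - S (real i * (t / n)) \<omega>"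
  define g :: "real \<Rightarrow> real" where "g y = 1 - indicator {w..} y" for y
  have gm [measurable]: "g \<in> borel_measurable borel"
    unfolding g_def by measurable
  have g_bd: "\<bar>g y\<bar> \<le> 1" for y by (auto simp: g_def indicator_def)
  note G = increments[OF n t gm g_bd]
  note [measurable] = S_measurable[OF t]
  have Gint: "integrable M (\<lambda>\<omega>. \<Prod>i<n. g (\<xi> i \<omega>))"
    and Gprod: "expectation (\<lambda>\<omega>. \<Prod>i<n. g (\<xi> i \<omega>)) = expectation (\<lambda>\<omega>. g (S (t / n) \<omega>)) ^ n"
    using G(3,4) by (simp_all add: \<xi>_def)
  have le: "AE \<omega> in M. 1 - (\<Prod>i<n. g (\<xi> i \<omega>)) \<le> indicator {w..} (S t \<omega>)"
    using G(5)
  proof eventually_elim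
    case (elim \<omega>)
    have el: "(\<Sum>i<n. \<xi> i \<omega>) = S t \<omega>" "\<And>i. 0 \<le> \<xi> i \<omega>"
      using elim by (simp_all add: \<xi>_def)
    show ?case
    proof (cases "\<exists>i<n. w \<le> \<xi> i \<omega>")
      case True
      then obtain i where i: "i < n" "w \<le> \<xi> i \<omega>" by blast
      have "\<xi> i \<omega> \<le> (\<Sum>i<n. \<xi> i \<omega>)"
        using i el by (intro member_le_sum) auto
      then have "w \<le> S t \<omega>" using i el by auto
      then show ?thesis by (auto simp: g_def indicator_def intro!: prod_nonneg)
    next
      case False
      then have "(\<Prod>i<n. g (\<xi> i \<omega>)) = 1" by (intro prod.neutral) (auto simp: g_def)
      then show ?thesis by simp
    qed
  qed
  have E: "expectation (\<lambda>\<omega>. g (S (t / n) \<omega>)) = 1 - expectation (\<lambda>\<omega>. indicator {w..} (S (t / n) \<omega>))"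
    unfolding g_def using t
    by (subst Bochner_Integration.integral_diff)
       (auto simp: prob_space indicator_def intro!: integrable_bounded_image[where C = 1])
  have "1 - (1 - expectation (\<lambda>\<omega>. indicator {w..} (S (t / n) \<omega>))) ^ n
      = expectation (\<lambda>\<omega>. 1 - (\<Prod>i<n. g (\<xi> i \<omega>)))"
    by (subst Bochner_Integration.integral_diff) (auto simp: Gint Gprod E prob_space)
  also have "\<dots> \<le> expectation (\<lambda>\<omega>. indicator {w..} (S t \<omega>))"
    using t by (intro integral_mono_AE le Bochner_Integration.integrable_diff Gint 
       integrable_bounded_image[where C = 1]) (auto simp: indicator_def)
  also have "\<dots> = prob {\<omega> \<in> space M. w \<le> S t \<omega>}"
    using expectation_indicator[OF t] by simp
  finally show ?thesis .
qed

end

lemma one_minus_exp_le: "1 - exp (- z) \<le> z" for z :: real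
  using exp_ge_add_one_self[of "- z"] by linarith

section \<open>Properties of \<phi> and H read off from Laplace transforms\<close>

context subordinator_laplace
begin

lemma phi_eq_ln: "0 < lam \<Longrightarrow> \<phi> lam = - ln (expectation (\<lambda>\<omega>. exp (- lam * S 1 \<omega>)))"
  using laplace[of 1 lam] by simp

text \<open>On the positive half line \<phi> is minus the logarithm of a positive differentiable
  Laplace transform. The explicit value is discarded: what matters is that \<open>deriv\<close> is a
  genuine derivative there.\<close>

lemma phi_has_derivative:
  assumes "0 < lam"
  shows "(\<phi> has_real_derivative deriv \<phi> lam) (at lam)"
proof -
  have "((\<lambda>l. - ln (expectation (\<lambda>\<omega>. exp (- l * S 1 \<omega>)))) has_real_derivative
      - (inverse (exp (- 1 * \<phi> lam)) * - expectation (\<lambda>\<omega>. S 1 \<omega> * exp (- lam * S 1 \<omega>)))) (at lam)"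
    using laplace_has_derivative(1)[OF S_measurable[of 1] S_nonneg assms] laplace[of 1 lam] assms
    by (intro DERIV_minus DERIV_chain2[where f = ln] DERIV_ln) (auto simp: DERIV_ln)
  then have "(\<phi> has_real_derivative
      - (inverse (exp (- 1 * \<phi> lam)) * - expectation (\<lambda>\<omega>. S 1 \<omega> * exp (- lam * S 1 \<omega>)))) (at lam)"
    by (rule has_field_derivative_transform_within_open[of _ _ _ "{0<..}"])
       (use assms in \<open>auto simp: phi_eq_ln\<close>)
  with DERIV_imp_deriv[OF this] show ?thesis by simp
qed

lemma expectation_one_minus_exp:
  assumes "0 \<le> t" "0 < lam"
  shows "expectation (\<lambda>\<omega>. 1 - exp (- (lam * S t \<omega>))) = 1 - exp (- (t * \<phi> lam))"
  using laplace[OF assms] assms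
  by (subst Bochner_Integration.integral_diff)
     (auto simp: prob_space intro!: integrable_bounded_image[where C = 1])

text \<open>Both sides of the Laplace identity are differentiated in lam and the two derivatives are
  identified.\<close>

lemma expectation_mult_exp:
  assumes t: "0 \<le> t" and lam: "0 < lam"
  shows "expectation (\<lambda>\<omega>. S t \<omega> * exp (- (lam * S t \<omega>))) = t * deriv \<phi> lam * exp (- (t * \<phi> lam))"
proof -
  have "((\<lambda>l. exp (- t * \<phi> l)) has_real_derivative exp (- t * \<phi> lam) * (- t * deriv \<phi> lam)) (at lam)"
    by (auto intro!: derivative_eq_intros phi_has_derivative[OF lam])
  then have "((\<lambda>l. expectation (\<lambda>\<omega>. exp (- l * S t \<omega>))) has_real_derivative
      exp (- t * \<phi> lam) * (- t * deriv \<phi> lam)) (at lam)"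
    by (rule has_field_derivative_transform_within_open[of _ _ _ "{0<..}"])
       (use lam laplace[OF t] in auto)
  from DERIV_unique[OF this laplace_has_derivative(1)[OF S_measurable[OF t] S_nonneg[OF t] lam]]
  show ?thesis by (simp add: mult_ac)
qed

text \<open>The expectation equals 1 - e^(-t\<phi>) - t lam \<phi>' e^(-t\<phi>); substituting lam
  \<phi>' = \<phi> - H separates a term quadratic in t from the term carrying t H. This is the
  origin of \<open>hfun\<close>.\<close>

lemma expectation_hfun:
  assumes t: "0 \<le> t" and lam: "0 < lam"
  shows "expectation (\<lambda>\<omega>. hfun (lam * S t \<omega>)) = hfun (t * \<phi> lam) + t * H lam * exp (- (t * \<phi> lam))"
proof -
  have int: "integrable M (\<lambda>\<omega>. S t \<omega> * exp (- (lam * S t \<omega>)))"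
    using laplace_has_derivative(2)[OF S_measurable[OF t] S_nonneg[OF t] lam] by simp
  have int1: "integrable M (\<lambda>\<omega>. 1 - exp (- (lam * S t \<omega>)))"
    using t lam by (intro integrable_bounded_image[where C = 1]) auto
  have "expectation (\<lambda>\<omega>. hfun (lam * S t \<omega>))
      = expectation (\<lambda>\<omega>. (1 - exp (- (lam * S t \<omega>))) - lam * (S t \<omega> * exp (- (lam * S t \<omega>))))"
    by (simp add: hfun_def mult.assoc)
  also have "\<dots> = 1 - exp (- (t * \<phi> lam)) - lam * (t * deriv \<phi> lam * exp (- (t * \<phi> lam)))"
    using int int1 expectation_one_minus_exp[OF t lam] expectation_mult_exp[OF t lam]
    by (subst Bochner_Integration.integral_diff) auto
  finally show ?thesis by (simp add: hfun_def H_of_def algebra_simps)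
qed

lemma integrable_hfun: "0 \<le> t \<Longrightarrow> 0 \<le> lam \<Longrightarrow> integrable M (\<lambda>\<omega>. hfun (lam * S t \<omega>))"
  by (intro integrable_bounded_image[where C = 1]) (auto simp: hfun_nonneg hfun_le_1)

lemma phi_nonneg: 
  assumes "0 < lam"
  shows "0 \<le> \<phi> lam"
proof -
  have "expectation (\<lambda>\<omega>. exp (- lam * S 1 \<omega>)) \<le> expectation (\<lambda>\<omega>. 1)"
    using assms by (intro integral_mono integrable_bounded_image[where C = 1]) (auto simp: S_nonneg)
  then show ?thesis using laplace[of 1 lam] assms by (simp add: prob_space)
qed

lemma phi_mono:
  assumes "0 < l" "l \<le> m"
  shows "\<phi> l \<le> \<phi> m"
proof -
  have "expectation (\<lambda>\<omega>. exp (- m * S 1 \<omega>)) \<le> expectation (\<lambda>\<omega>. exp (- l * S 1 \<omega>))"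
    using assms by (intro integral_mono integrable_bounded_image[where C = 1]) (auto simp: S_nonneg mult_right_mono)
  then show ?thesis using laplace[of 1 l] laplace[of 1 m] assms by simp
qed

text \<open>Equality would give a nonnegative variable of expectation 0, hence S 1 = 0 almost surely
  and \<phi> l = 0.\<close>

lemma phi_strict_mono:
  assumes "0 < l" "l < m" "0 < \<phi> l"
  shows "\<phi> l < \<phi> m"
proof (rule ccontr)
  assume "\<not> \<phi> l < \<phi> m"
  then have eq: "\<phi> l = \<phi> m" using phi_mono[of l m] assms by simp
  have int: "integrable M (\<lambda>\<omega>. exp (- l * S 1 \<omega>))" "integrable M (\<lambda>\<omega>. exp (- m * S 1 \<omega>))"
    using assms by (auto intro!: integrable_bounded_image[where C = 1])
  have "expectation (\<lambda>\<omega>. exp (- l * S 1 \<omega>) - exp (- m * S 1 \<omega>)) = 0"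
    using eq assms laplace[of 1 l] laplace[of 1 m] int by simp
  then have "AE \<omega> in M. exp (- l * S 1 \<omega>) - exp (- m * S 1 \<omega>) = 0"
    using assms int by (subst (asm) integral_nonneg_eq_0_iff_AE) (auto simp: S_nonneg mult_right_mono)
  then have "AE \<omega> in M. exp (- l * S 1 \<omega>) = 1"
    by eventually_elim (use assms in auto)
  then have "expectation (\<lambda>\<omega>. exp (- l * S 1 \<omega>)) = expectation (\<lambda>\<omega>. 1)"
    using int by (intro integral_cong_AE) auto
  then show False using assms laplace[of 1 l] by (simp add: prob_space)
qed

text \<open>Supplies the lower endpoint of the intermediate value argument in
  \<open>phi_inv\<close>.\<close>

lemma phi_tendsto_0: "(\<lambda>n. \<phi> (1 / Suc n)) \<longlonglongrightarrow> 0"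
proof -
  have "(\<lambda>n. expectation (\<lambda>\<omega>. exp (- (1 / real (Suc n)) * S 1 \<omega>))) \<longlonglongrightarrow> expectation (\<lambda>\<omega>. exp (- 0 * S 1 \<omega>))"
  proof (rule integral_dominated_convergence[where w = "\<lambda>_. 1"])
    have "(\<lambda>n. 1 / real (Suc n)) \<longlonglongrightarrow> 0" by real_asymp
    then show "AE \<omega> in M. (\<lambda>n. exp (- (1 / real (Suc n)) * S 1 \<omega>)) \<longlonglongrightarrow> exp (- 0 * S 1 \<omega>)"
      by (intro AE_I2 tendsto_intros)
  qed (use S_measurable[of 1] in \<open>auto simp: S_nonneg\<close>)
  then have "(\<lambda>n. - ln (expectation (\<lambda>\<omega>. exp (- (1 / real (Suc n)) * S 1 \<omega>)))) \<longlonglongrightarrow> - ln 1"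
    by (intro tendsto_intros) (auto simp: prob_space)
  then show ?thesis by (subst phi_eq_ln) auto
qed

text \<open>Stands in for the integral of h(lam s) against the Levy measure: sign, monotonicity and
  the quadratic growth bound of h pass to H through this limit. Convergence holds because n
  h(\<phi>/n) is at most \<phi>^2/(2n).\<close>

lemma H_tendsto:
  assumes "0 < lam"
  shows "(\<lambda>n. real (Suc n) * expectation (\<lambda>\<omega>. hfun (lam * S (1 / Suc n) \<omega>))) \<longlonglongrightarrow> H lam"
proof -
  define a where "a = \<phi> lam"
  have a: "0 \<le> a" using phi_nonneg[OF assms] by (simp add: a_def)
  have "(\<lambda>n. real (Suc n) * hfun (1 / Suc n * a)) \<longlonglongrightarrow> 0"
  proof (rule tendsto_sandwich)
    have "real (Suc n) * hfun (1 / Suc n * a) \<le> a\<^sup>2 / 2 / Suc n" for n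
    proof -
      have "real (Suc n) * hfun (1 / Suc n * a) \<le> real (Suc n) * ((1 / Suc n * a)\<^sup>2 / 2)"
        using a by (intro mult_left_mono hfun_le_square) auto
      also have "\<dots> = a\<^sup>2 / 2 / Suc n"
        by (simp add: power2_eq_square del: of_nat_Suc)
      finally show ?thesis .
    qed
    then show "\<forall>\<^sub>F n in sequentially. real (Suc n) * hfun (1 / Suc n * a) \<le> a\<^sup>2 / 2 / Suc n" by simp
    show "\<forall>\<^sub>F n in sequentially. 0 \<le> real (Suc n) * hfun (1 / Suc n * a)"
      using a by (intro always_eventually allI mult_nonneg_nonneg hfun_nonneg) auto
    show "(\<lambda>n. a\<^sup>2 / 2 / Suc n) \<longlonglongrightarrow> 0" by real_asymp
  qed simp
  moreover have "(\<lambda>n. H lam * exp (- (1 / Suc n * a))) \<longlonglongrightarrow> H lam * exp (- 0)"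
    by (intro tendsto_intros) real_asymp
  ultimately have "(\<lambda>n. real (Suc n) * hfun (1 / Suc n * a) + H lam * exp (- (1 / Suc n * a))) \<longlonglongrightarrow> 0 + H lam * exp (- 0)"
    by (rule tendsto_add)
  moreover have "real (Suc n) * expectation (\<lambda>\<omega>. hfun (lam * S (1 / Suc n) \<omega>))
      = real (Suc n) * hfun (1 / Suc n * a) + H lam * exp (- (1 / Suc n * a))" for n
    by (subst expectation_hfun) (use assms in \<open>auto simp: a_def field_simps\<close>)
  ultimately show ?thesis by simp
qed

lemma H_nonneg: "0 < lam \<Longrightarrow> 0 \<le> H lam"
  by (rule LIMSEQ_le_const[OF H_tendsto])
     (auto intro!: exI[of _ 0] mult_nonneg_nonneg Bochner_Integration.integral_nonneg hfun_nonneg S_nonneg simp del: of_nat_Suc)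

lemma H_mono: 
  assumes "0 < l" "l \<le> m"
  shows "H l \<le> H m"
  using assms
  by (intro LIMSEQ_le[OF H_tendsto H_tendsto])
     (auto intro!: exI[of _ 0] mult_left_mono integral_mono integrable_hfun hfun_mono S_nonneg mult_right_mono mult_nonneg_nonneg simp del: of_nat_Suc)

lemma H_scale: 
  assumes "1 \<le> c" "0 < l"
  shows "H (c * l) \<le> c\<^sup>2 * H l"
proof (rule LIMSEQ_le[OF H_tendsto tendsto_mult_left[OF H_tendsto]])
  have "real (Suc n) * expectation (\<lambda>\<omega>. hfun (c * l * S (1 / Suc n) \<omega>))
      \<le> c\<^sup>2 * (real (Suc n) * expectation (\<lambda>\<omega>. hfun (l * S (1 / Suc n) \<omega>)))" for n
  proof -
    have "expectation (\<lambda>\<omega>. hfun (c * l * S (1 / Suc n) \<omega>)) \<le> expectation (\<lambda>\<omega>. c\<^sup>2 * hfun (l * S (1 / Suc n) \<omega>))"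
      using assms hfun_scale[OF assms(1)]
      by (intro integral_mono integrable_mult_right integrable_hfun) (auto simp: mult.assoc S_nonneg)
    then show ?thesis using assms by (simp add: mult.left_commute mult_left_mono del: of_nat_Suc)
  qed
  then show "\<exists>N. \<forall>n\<ge>N. real (Suc n) * expectation (\<lambda>\<omega>. hfun (c * l * S (1 / Suc n) \<omega>))
      \<le> c\<^sup>2 * (real (Suc n) * expectation (\<lambda>\<omega>. hfun (l * S (1 / Suc n) \<omega>)))" by blast
qed (use assms in auto)

lemma H_le_phi: 
  assumes "0 < lam"
  shows "H lam \<le> \<phi> lam"
proof -
  have "0 \<le> expectation (\<lambda>\<omega>. S 1 \<omega> * exp (- (lam * S 1 \<omega>)))"
    by (auto intro!: Bochner_Integration.integral_nonneg simp: S_nonneg)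
  then have "0 \<le> deriv \<phi> lam * exp (- \<phi> lam)"
    using expectation_mult_exp[of 1 lam] assms by simp
  then have "0 \<le> deriv \<phi> lam" by (simp add: zero_le_mult_iff)
  then show ?thesis using assms by (simp add: H_of_def)
qed

section \<open>Upper and lower tails of S t\<close>

lemma expectation_hfun_le:
  assumes t: "0 \<le> t" and lam: "0 < lam"
  shows "expectation (\<lambda>\<omega>. hfun (lam * S t \<omega>)) \<le> t * H lam + (t * \<phi> lam)\<^sup>2 / 2"
proof -
  have "hfun (t * \<phi> lam) \<le> (t * \<phi> lam)\<^sup>2 / 2"
    using assms phi_nonneg by (intro hfun_le_square) auto
  moreover have "t * H lam * exp (- (t * \<phi> lam)) \<le> t * H lam"
    using assms phi_nonneg[OF lam] H_nonneg[OF lam] by (intro mult_left_le) auto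
  ultimately show ?thesis unfolding expectation_hfun[OF assms] by linarith
qed

lemma expectation_hfun_ge:
  assumes t: "0 \<le> t" and lam: "0 < lam"
  shows "t * H lam * exp (- (t * \<phi> lam)) \<le> expectation (\<lambda>\<omega>. hfun (lam * S t \<omega>))"
  unfolding expectation_hfun[OF assms] using assms phi_nonneg[OF lam] by (simp add: hfun_nonneg)

text \<open>Markov's inequality for 1 - e^(-S_t/v). It sees \<phi> rather than H, which suffices at
  the central scale 1/r, where t \<phi> is of order 1.\<close>

lemma prob_ge_le_phi:
  assumes t: "0 \<le> t" and v: "0 < v"
  shows "prob {\<omega> \<in> space M. v \<le> S t \<omega>} \<le> 2 * (t * \<phi> (1 / v))"
proof -
  have "prob {\<omega> \<in> space M. v \<le> S t \<omega>} = expectation (\<lambda>\<omega>. indicator {v..} (S t \<omega>) :: real)"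
    using expectation_indicator[OF t] by simp
  also have "\<dots> \<le> expectation (\<lambda>\<omega>. 2 * (1 - exp (- (1 / v * S t \<omega>))))"
  proof (intro integral_mono integrable_mult_right)
    show "indicator {v..} (S t \<omega>) \<le> 2 * (1 - exp (- (1 / v * S t \<omega>)))" if "\<omega> \<in> space M" for \<omega>
      using one_le_one_minus_exp[of "1 / v * S t \<omega>"] S_nonneg[OF t that] v
      by (auto simp: indicator_def field_simps)
  qed (use t v in \<open>auto intro!: integrable_bounded_image[where C = 1] simp: indicator_def\<close>)
  also have "\<dots> = 2 * (1 - exp (- (t * \<phi> (1 / v))))"
    unfolding integral_mult_right_zero using v by (subst expectation_one_minus_exp[OF t]) auto
  also have "\<dots> \<le> 2 * (t * \<phi> (1 / v))"
    by (intro mult_left_mono one_minus_exp_le) simp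
  finally show ?thesis .
qed

text \<open>Markov's inequality for e^(-S_t/v). Combined with scaling (L) it makes very small values
  of S_t rarer than any power, which is the source of the negative moments.\<close>

lemma prob_le_le_phi:
  assumes t: "0 \<le> t" and v: "0 < v"
  shows "prob {\<omega> \<in> space M. S t \<omega> \<le> v} \<le> exp (1 - t * \<phi> (1 / v))"
proof -
  have "prob {\<omega> \<in> space M. S t \<omega> \<le> v} = expectation (\<lambda>\<omega>. indicator {..v} (S t \<omega>) :: real)"
    using expectation_indicator[OF t] by simp
  also have "\<dots> \<le> expectation (\<lambda>\<omega>. exp 1 * exp (- (1 / v) * S t \<omega>))"
  proof (intro integral_mono integrable_mult_right)
    show "indicator {..v} (S t \<omega>) \<le> exp 1 * exp (- (1 / v) * S t \<omega>)" if "\<omega> \<in> space M" for \<omega>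
      using v by (auto simp: indicator_def simp flip: exp_add)
  qed (use t v in \<open>auto intro!: integrable_bounded_image[where C = 1] simp: indicator_def\<close>)
  also have "\<dots> = exp 1 * exp (- t * \<phi> (1 / v))"
    using laplace[OF t, of "1 / v"] v by simp
  finally show ?thesis by (simp flip: exp_add)
qed

text \<open>The subordinator is cut into \<open>n\<close> independent pieces; letting \<open>n\<close> tend to infinity removes
  the quadratic error in \<open>expectation_hfun_le\<close>, so that only the one-jump term \<open>t H(1/w)\<close>
  survives.\<close>

lemma upper_tail:
  assumes t: "0 < t" and w: "0 < w" and small: "3 * (t * \<phi> (1 / w)) \<le> 1" and H: "0 < H (1 / w)"
  shows "prob {\<omega> \<in> space M. 3 * w \<le> S t \<omega>} \<le> (6 + exp 6) * (t * H (1 / w))"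
proof (cases "1 \<le> t * H (1 / w)")
  case True
  have "1 \<le> (6 + exp 6) * (t * H (1 / w))"
    using mult_mono[of 1 "6 + exp 6" 1 "t * H (1 / w)"] True by (simp add: add_increasing2)
  then show ?thesis using prob_le_1 order_trans by blast
next
  case False
  define A where "A = t * H (1 / w)"
  have A: "0 < A" "A < 1" using False t H by (auto simp: A_def)
  \<comment> \<open>With this L the large coefficient e^(2L) times A is exactly 1, while e^(-2L) = A
    is the bound wanted. The threshold 3w produces e^(-3L): two factors give A, the third pays for
    the linear term of the Chernoff exponent.\<close>
  define L where "L = - ln A / 2"
  have L: "0 \<le> L" "exp (2 * L) = 1 / A" "exp (- (2 * L)) = A"
    using A by (auto simp: L_def exp_minus field_simps)
  define a where "a = t * \<phi> (1 / w)"
  have a: "0 \<le> a" "3 * a \<le> 1" using small t w phi_nonneg[of "1 / w"] by (auto simp: a_def)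
  \<comment> \<open>\<open>B n\<close> bounds n E h(X/w) for a piece X of length t/n; its second
    summand is the quadratic error that disappears as n grows.\<close>
  define B where "B n = A + a\<^sup>2 / 2 / n" for n :: nat
  define R where "R n = 6 * B n + exp (- (3 * L)) * exp (3 * L * a + 6 * exp (2 * L) * B n)" for n
  have bound: "prob {\<omega> \<in> space M. 3 * w \<le> S t \<omega>} \<le> R n" if n: "0 < n" for n
  proof -
    define X where "X = S (t / n)"
    define Eh where "Eh = expectation (\<lambda>\<omega>. hfun (1 / w * X \<omega>))"
    have tn: "0 \<le> t / n" using t by simp
    have X: "0 \<le> 1 / w * X \<omega>" if "\<omega> \<in> space M" for \<omega>
      using S_nonneg[OF tn that] w by (simp add: X_def)
    have inth: "integrable M (\<lambda>\<omega>. hfun (1 / w * X \<omega>))"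
      unfolding X_def using tn w by (intro integrable_hfun) auto
    have inte: "integrable M (\<lambda>\<omega>. 1 - exp (- (1 / w * X \<omega>)))"
      unfolding X_def using tn w by (intro integrable_bounded_image[where C = 1]) auto
    have Eh: "n * Eh \<le> B n"
    proof -
      have "n * Eh \<le> n * (t / n * H (1 / w) + (t / n * \<phi> (1 / w))\<^sup>2 / 2)"
        unfolding Eh_def X_def using tn w by (intro mult_left_mono expectation_hfun_le) auto
      also have "\<dots> = B n"
        using n by (simp add: B_def A_def a_def power2_eq_square field_simps)
      finally show ?thesis .
    qed
    have Ee: "n * expectation (\<lambda>\<omega>. 1 - exp (- (1 / w * X \<omega>))) \<le> a"
    proof -
      have "expectation (\<lambda>\<omega>. 1 - exp (- (1 / w * X \<omega>))) = 1 - exp (- (t / n * \<phi> (1 / w)))"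
        unfolding X_def by (rule expectation_one_minus_exp) (use t w in auto)
      also have "\<dots> \<le> t / n * \<phi> (1 / w)" by (rule one_minus_exp_le)
      finally have "n * expectation (\<lambda>\<omega>. 1 - exp (- (1 / w * X \<omega>))) \<le> n * (t / n * \<phi> (1 / w))"
        by (intro mult_left_mono) auto
      then show ?thesis using n by (simp add: a_def)
    qed
    have first: "expectation (\<lambda>\<omega>. indicator {w<..} (X \<omega>)) \<le> 6 * Eh"
    proof -
      have "expectation (\<lambda>\<omega>. indicator {w<..} (X \<omega>)) \<le> expectation (\<lambda>\<omega>. 6 * hfun (1 / w * X \<omega>))"
      proof (intro integral_mono integrable_mult_right inth)
        show "indicator {w<..} (X \<omega>) \<le> 6 * hfun (1 / w * X \<omega>)" if "\<omega> \<in> space M" for \<omega>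
          using one_le_hfun[of "1 / w * X \<omega>"] hfun_nonneg[OF X[OF that]] w
          by (auto simp: indicator_def field_simps)
      qed (use tn in \<open>auto simp: X_def indicator_def intro!: integrable_bounded_image[where C = 1]\<close>)
      then show ?thesis by (simp add: Eh_def)
    qed
    define g where "g y = exp (L / w * (if y \<le> w then max 0 y else 0))" for y :: real
    have gm: "g \<in> borel_measurable borel" unfolding g_def by measurable
    have g_bd: "\<bar>g y\<bar> \<le> exp (L / w * w)" for y
      unfolding g_def abs_exp_cancel exp_le_cancel_iff using L w by (intro mult_left_mono) auto
    \<comment> \<open>With y = X/w, the linear part of e^(Ly) is dominated by 1 - e^(-y) and the
      quadratic part by h(y), both of known expectation. For y > 1 the truncated weight is just
      1.\<close>
    have "expectation (\<lambda>\<omega>. g (X \<omega>)) \<le> expectation (\<lambda>\<omega>. 1 + (3 * L * (1 - exp (- (1 / w * X \<omega>)))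
         + 6 * exp (2 * L) * hfun (1 / w * X \<omega>)))"
    proof (rule integral_mono)
      show "g (X \<omega>) \<le> 1 + (3 * L * (1 - exp (- (1 / w * X \<omega>))) + 6 * exp (2 * L) * hfun (1 / w * X \<omega>))"
        if "\<omega> \<in> space M" for \<omega>
      proof -
        define y where "y = 1 / w * X \<omega>"
        have y: "0 \<le> y" "X \<omega> = w * y" using X[OF that] w by (auto simp: y_def)
        show ?thesis
        proof (cases "y \<le> 1")
          case True
          then have "X \<omega> \<le> w" using y w by (simp add: mult_le_cancel_left1)
          then have "g (X \<omega>) = exp (L * y)" using y w by (simp add: g_def)
          also have "\<dots> \<le> 1 + L * y + y\<^sup>2 * exp (2 * L)" by (rule exp_mult_le_quadratic[OF L(1) y(1) True])
          also have "\<dots> \<le> 1 + L * (3 * (1 - exp (- y))) + 6 * hfun y * exp (2 * L)"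
            using le_one_minus_exp[OF y(1) True] square_le_hfun[OF y(1) True] L(1)
            by (intro add_mono mult_left_mono mult_right_mono) auto
          finally show ?thesis by (simp add: y_def mult_ac)
        next
          case False
          then have "\<not> X \<omega> \<le> w" using y w by (simp add: mult_le_cancel_left1)
          then have "g (X \<omega>) = 1" by (simp add: g_def)
          also have "1 \<le> 1 + (3 * L * (1 - exp (- y)) + 6 * exp (2 * L) * hfun y)"
            using y(1) L(1) hfun_nonneg[OF y(1)] by simp
          finally show ?thesis by (simp only: y_def)
        qed
      qed
      show "integrable M (\<lambda>\<omega>. g (X \<omega>))" unfolding X_def
        by (rule integrable_bounded_image[OF tn gm g_bd])
    qed (intro Bochner_Integration.integrable_add integrable_mult_right inth inte integrable_const)
    also have "\<dots> = 1 + (3 * L * expectation (\<lambda>\<omega>. 1 - exp (- (1 / w * X \<omega>))) + 6 * exp (2 * L) * Eh)"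
      using inth inte by (simp add: Eh_def prob_space)
    also have "\<dots> \<le> exp (3 * L * expectation (\<lambda>\<omega>. 1 - exp (- (1 / w * X \<omega>))) + 6 * exp (2 * L) * Eh)"
      by (rule exp_ge_add_one_self)
    finally have "expectation (\<lambda>\<omega>. g (X \<omega>)) ^ n
        \<le> exp (3 * L * expectation (\<lambda>\<omega>. 1 - exp (- (1 / w * X \<omega>))) + 6 * exp (2 * L) * Eh) ^ n"
      by (intro power_mono Bochner_Integration.integral_nonneg) (auto simp: g_def)
    also have "\<dots> = exp (3 * L * (n * expectation (\<lambda>\<omega>. 1 - exp (- (1 / w * X \<omega>)))) + 6 * exp (2 * L) * (n * Eh))"
      by (simp add: distrib_left mult_ac del: exp_le_cancel_iff flip: exp_of_nat_mult)
    also have "\<dots> \<le> exp (3 * L * a + 6 * exp (2 * L) * B n)"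
      unfolding exp_le_cancel_iff using Ee Eh L(1) by (intro add_mono mult_left_mono) auto
    finally have second: "expectation (\<lambda>\<omega>. g (X \<omega>)) ^ n \<le> exp (3 * L * a + 6 * exp (2 * L) * B n)" .
    have "prob {\<omega> \<in> space M. 3 * w \<le> S t \<omega>} \<le> n * expectation (\<lambda>\<omega>. indicator {w<..} (X \<omega>))
        + exp (- (L / w) * (3 * w)) * expectation (\<lambda>\<omega>. g (X \<omega>)) ^ n"
      unfolding X_def g_def using n t L w by (intro prob_ge_le_increments) auto
    also have "\<dots> \<le> n * (6 * Eh) + exp (- (L / w) * (3 * w)) * exp (3 * L * a + 6 * exp (2 * L) * B n)"
      by (intro add_mono mult_left_mono first second) auto
    also have "\<dots> \<le> R n" using Eh w by (simp add: R_def mult.commute[of L 3])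
    finally show ?thesis .
  qed
  have "(\<lambda>n. a\<^sup>2 / 2 / real (Suc n)) \<longlonglongrightarrow> 0" by real_asymp
  then have "(\<lambda>n. B (Suc n)) \<longlonglongrightarrow> A + 0" unfolding B_def by (intro tendsto_intros)
  then have "(\<lambda>n. R (Suc n)) \<longlonglongrightarrow> 6 * (A + 0) + exp (- (3 * L)) * exp (3 * L * a + 6 * exp (2 * L) * (A + 0))"
    unfolding R_def by (intro tendsto_intros)
  then have "prob {\<omega> \<in> space M. 3 * w \<le> S t \<omega>} \<le> 6 * (A + 0) + exp (- (3 * L)) * exp (3 * L * a + 6 * exp (2 * L) * (A + 0))"
    using bound by (intro LIMSEQ_le_const) auto
  also have "\<dots> = 6 * A + exp (- (3 * L) + (3 * a * L + 6))"
  proof -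
    have "6 * exp (2 * L) * (A + 0) = 6" using A by (simp add: L)
    moreover have "3 * L * a = 3 * a * L" by simp
    ultimately show ?thesis by (simp only: exp_add add_0_right)
  qed
  \<comment> \<open>Here 3a \<le> 1 is used: the linear term 3aL costs at most one L.\<close>
  also have "\<dots> \<le> 6 * A + exp (- (2 * L) + 6)"
    using mult_right_mono[OF a(2) L(1)] by simp
  also have "\<dots> = (6 + exp 6) * A"
    unfolding exp_add L(3) by (simp add: distrib_right)
  finally show ?thesis by (simp add: A_def)
qed

text \<open>For a piece X, h(X/(Kw)) is at most the indicator of X \<ge> w plus 3/K^2 times h(X/w):
  above w because h \<le> 1, below w because h is comparable with the square. Taking expectations
  and letting n tend to infinity bounds from below the expected number of pieces of size at least w,
  and (1 - Q)^n \<le> e^(-nQ) turns this into a probability. A positive c exists as soon as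
  H(1/(Kw)) exceeds the fraction 3/K^2 of H(1/w).\<close>

lemma lower_tail:
  assumes t: "0 < t" and w: "0 < w" and K: "1 \<le> K"
    and c: "c * H (1 / w) \<le> H (1 / (K * w)) - 3 / K\<^sup>2 * H (1 / w)"
  shows "1 - exp (- (c * (t * H (1 / w)))) \<le> prob {\<omega> \<in> space M. w \<le> S t \<omega>}"
proof -
  define a where "a = t * \<phi> (1 / w)"
  define b where "b = t * \<phi> (1 / (K * w))"
  define R where "R n = t * H (1 / (K * w)) * exp (- (b / n)) - 3 / K\<^sup>2 * (t * H (1 / w) + a\<^sup>2 / 2 / n)" for n :: nat
  have bound: "1 - exp (- R n) \<le> prob {\<omega> \<in> space M. w \<le> S t \<omega>}" if n: "0 < n" for n
  proof -
    define X where "X = S (t / n)"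
    have tn: "0 \<le> t / n" using t by simp
    have X: "0 \<le> X \<omega>" if "\<omega> \<in> space M" for \<omega>
      using S_nonneg[OF tn that] by (simp add: X_def)
    define Q where "Q = expectation (\<lambda>\<omega>. indicator {w..} (X \<omega>) :: real)"
    have Q1: "Q \<le> 1"
      unfolding Q_def X_def using tn by (simp add: expectation_indicator)
    have "expectation (\<lambda>\<omega>. hfun (1 / (K * w) * X \<omega>))
        \<le> expectation (\<lambda>\<omega>. indicator {w..} (X \<omega>) + 3 / K\<^sup>2 * hfun (1 / w * X \<omega>))"
    proof (rule integral_mono)
      show "hfun (1 / (K * w) * X \<omega>) \<le> indicator {w..} (X \<omega>) + 3 / K\<^sup>2 * hfun (1 / w * X \<omega>)"
        if "\<omega> \<in> space M" for \<omega>
      proof (cases "w \<le> X \<omega>")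
        case True
        have "hfun (1 / (K * w) * X \<omega>) \<le> 1" using X[OF that] w K by (intro hfun_le_1) auto
        moreover have "0 \<le> 3 / K\<^sup>2 * hfun (1 / w * X \<omega>)"
          using X[OF that] w by (intro mult_nonneg_nonneg hfun_nonneg) auto
        ultimately show ?thesis using True by simp
      next
        case False
        have "hfun (1 / (K * w) * X \<omega>) \<le> (1 / (K * w) * X \<omega>)\<^sup>2 / 2"
          using X[OF that] w K by (intro hfun_le_square) auto
        also have "\<dots> = 1 / (2 * K\<^sup>2) * (1 / w * X \<omega>)\<^sup>2" by (simp add: power2_eq_square)
        also have "\<dots> \<le> 1 / (2 * K\<^sup>2) * (6 * hfun (1 / w * X \<omega>))"
          using X[OF that] w False by (intro mult_left_mono square_le_hfun) auto
        finally show ?thesis using False by simp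
      qed
      show "integrable M (\<lambda>\<omega>. hfun (1 / (K * w) * X \<omega>))"
        unfolding X_def using tn w K by (intro integrable_hfun) auto
      show "integrable M (\<lambda>\<omega>. indicator {w..} (X \<omega>) + 3 / K\<^sup>2 * hfun (1 / w * X \<omega>))"
        unfolding X_def using tn w
        by (intro Bochner_Integration.integrable_add integrable_mult_right integrable_hfun
            integrable_bounded_image[where C = 1]) (auto simp: indicator_def)
    qed
    also have "\<dots> = Q + 3 / K\<^sup>2 * expectation (\<lambda>\<omega>. hfun (1 / w * X \<omega>))"
      unfolding Q_def X_def using tn w
      by (subst Bochner_Integration.integral_add)
         (auto intro!: integrable_hfun integrable_mult_right
            integrable_bounded_image[where C = 1] simp: indicator_def simp del: times_divide_eq_left)
    also have "\<dots> \<le> Q + 3 / K\<^sup>2 * (t / n * H (1 / w) + (t / n * \<phi> (1 / w))\<^sup>2 / 2)"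
      unfolding X_def using tn w by (intro add_left_mono mult_left_mono expectation_hfun_le) auto
    finally have "t / n * H (1 / (K * w)) * exp (- (t / n * \<phi> (1 / (K * w))))
        \<le> Q + 3 / K\<^sup>2 * (t / n * H (1 / w) + (t / n * \<phi> (1 / w))\<^sup>2 / 2)"
      using expectation_hfun_ge[OF tn, of "1 / (K * w)"] w K by (simp add: X_def)
    then have "n * (t / n * H (1 / (K * w)) * exp (- (t / n * \<phi> (1 / (K * w)))))
        \<le> n * (Q + 3 / K\<^sup>2 * (t / n * H (1 / w) + (t / n * \<phi> (1 / w))\<^sup>2 / 2))"
      by (rule mult_left_mono) simp
    moreover have "n * (t / n * H (1 / (K * w)) * exp (- (t / n * \<phi> (1 / (K * w)))))
        = t * H (1 / (K * w)) * exp (- (b / n))"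
      using n by (simp add: b_def)
    moreover have "n * (Q + 3 / K\<^sup>2 * (t / n * H (1 / w) + (t / n * \<phi> (1 / w))\<^sup>2 / 2))
        = n * Q + 3 / K\<^sup>2 * (t * H (1 / w) + a\<^sup>2 / 2 / n)"
    proof -
      have "n * (t / n * H (1 / w) + (t / n * \<phi> (1 / w))\<^sup>2 / 2) = t * H (1 / w) + a\<^sup>2 / 2 / n"
        using n by (simp add: a_def power2_eq_square field_simps)
      moreover have "n * (Q + k * Z) = n * Q + k * (n * Z)" for k Z :: real
        by (simp add: algebra_simps)
      ultimately show ?thesis by (simp only:)
    qed
    ultimately have "R n \<le> n * Q" by (simp add: R_def)
    have "1 - exp (- R n) \<le> 1 - exp (- (n * Q))" using \<open>R n \<le> n * Q\<close> by simp
    also have "\<dots> = 1 - exp (- Q) ^ n" by (simp flip: exp_of_nat_mult)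
    also have "\<dots> \<le> 1 - (1 - Q) ^ n"
      using exp_ge_add_one_self[of "- Q"] Q1 by (intro diff_left_mono power_mono) auto
    also have "\<dots> \<le> prob {\<omega> \<in> space M. w \<le> S t \<omega>}"
      unfolding Q_def X_def using n t by (intro prob_ge_ge_increments) auto
    finally show ?thesis .
  qed
  have "(\<lambda>n. b / real (Suc n)) \<longlonglongrightarrow> 0" "(\<lambda>n. a\<^sup>2 / 2 / real (Suc n)) \<longlonglongrightarrow> 0" by real_asymp+
  then have "(\<lambda>n. 1 - exp (- R (Suc n))) \<longlonglongrightarrow> 1 - exp (- (t * H (1 / (K * w)) * exp (- 0) - 3 / K\<^sup>2 * (t * H (1 / w) + 0)))"
    unfolding R_def by (intro tendsto_intros)
  then have "1 - exp (- (t * H (1 / (K * w)) * exp (- 0) - 3 / K\<^sup>2 * (t * H (1 / w) + 0))) \<le> prob {\<omega> \<in> space M. w \<le> S t \<omega>}"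
    using bound by (intro LIMSEQ_le_const2) auto
  moreover have "c * (t * H (1 / w)) \<le> t * H (1 / (K * w)) * exp (- 0) - 3 / K\<^sup>2 * (t * H (1 / w) + 0)"
    using mult_left_mono[OF c, of t] t by (simp add: algebra_simps)
  ultimately show ?thesis by (smt (verit) exp_le_cancel_iff)
qed

end

section \<open>The absence of drift\<close>

locale driftless_subordinator = subordinator_laplace +
  fixes \<mu> :: "real measure"
  assumes levy: "has_drift_and_levy_measure \<phi> 0 \<mu>"
begin

lemma phi_eq: "0 < lam \<Longrightarrow> \<phi> lam = (\<integral>s. 1 - exp (- lam * s) \<partial>\<mu>)"
  using levy by (simp add: has_drift_and_levy_measure_def)

lemma levy_measure: "levy_measure \<mu>"
  using levy by (simp add: has_drift_and_levy_measure_def)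

lemma space_levy: "space \<mu> = {0<..}"
  using levy_measure sets_eq_imp_space_eq[of \<mu> "restrict_space borel {0<..}"]
  by (simp add: levy_measure_def space_restrict_space)

lemma measurable_levy: 
  fixes f :: "real \<Rightarrow> real"
  assumes "f \<in> borel_measurable borel" shows "f \<in> borel_measurable \<mu>"
proof -
  have "f \<in> borel_measurable (restrict_space borel {0<..})"
    using assms by (rule measurable_restrict_space1)
  moreover have "sets \<mu> = sets (restrict_space borel {0<..})"
    using levy_measure by (simp add: levy_measure_def)
  ultimately show ?thesis using measurable_cong_sets by blast
qed

lemma integrable_min: "integrable \<mu> (\<lambda>s. min 1 s)"
proof (rule integrableI_nonneg)
  show "(\<lambda>s. min 1 s) \<in> borel_measurable \<mu>" by (rule measurable_levy) measurable
  show "AE s in \<mu>. 0 \<le> min 1 s" by (rule AE_I2) (auto simp: space_levy)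
  show "(\<integral>\<^sup>+ s. ennreal (min 1 s) \<partial>\<mu>) < \<infinity>" using levy_measure by (simp add: levy_measure_def)
qed

lemma one_minus_exp_le_min:
  fixes lam s :: real
  assumes "0 < lam" "0 < s"
  shows "1 - exp (- lam * s) \<le> max 1 lam * min 1 s"
proof (cases "s \<le> 1")
  case True
  have "1 - exp (- lam * s) \<le> lam * s" using one_minus_exp_le[of "lam * s"] by simp
  also have "\<dots> \<le> max 1 lam * s" using assms by (intro mult_right_mono) auto
  finally show ?thesis using True by simp
next
  case False
  have "1 - exp (- lam * s) \<le> 1" by simp
  also have "1 \<le> max 1 lam * min 1 s" using False by simp
  finally show ?thesis .
qed

lemma integrable_levy:
  assumes "0 < lam"
  shows "integrable \<mu> (\<lambda>s. 1 - exp (- lam * s))"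
proof (rule Bochner_Integration.integrable_bound[OF integrable_mult_right[OF integrable_min]])
  show "(\<lambda>s. 1 - exp (- lam * s)) \<in> borel_measurable \<mu>" by (rule measurable_levy) measurable
  show "AE s in \<mu>. norm (1 - exp (- lam * s)) \<le> norm (max 1 lam * min 1 s)"
    using assms one_minus_exp_le_min[OF assms]
    by (intro AE_I2) (auto simp: space_levy abs_mult)
qed

lemma phi_scale:
  assumes "1 \<le> c" "0 < lam"
  shows "\<phi> (c * lam) \<le> c * \<phi> lam"
proof -
  have "\<phi> (c * lam) = (\<integral>s. 1 - exp (- (c * lam) * s) \<partial>\<mu>)" using assms by (intro phi_eq) auto
  also have "\<dots> \<le> (\<integral>s. c * (1 - exp (- lam * s)) \<partial>\<mu>)"
    using assms one_minus_exp_scale[OF assms(1)]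
    by (intro integral_mono integrable_mult_right integrable_levy) (auto simp: space_levy mult.assoc)
  also have "\<dots> = c * \<phi> lam" using phi_eq[OF assms(2)] by simp
  finally show ?thesis .
qed

text \<open>Dominated convergence under the Levy measure: for l \<ge> c the integrand (1 -
  e^(-ls))/l is at most max(1, 1/c) min(1, s). The limit is taken along multiples of c because
  \<open>scaling_L_phi\<close> needs it simultaneously for c = x and c = 1.\<close>

lemma phi_over_tendsto_0:
  assumes c: "0 < c"
  shows "(\<lambda>n. \<phi> (real (Suc n) * c) / (real (Suc n) * c)) \<longlonglongrightarrow> 0"
proof -
  have eq: "\<phi> (real (Suc n) * c) / (real (Suc n) * c)
      = (\<integral>s. (1 - exp (- (real (Suc n) * c) * s)) / (real (Suc n) * c) \<partial>\<mu>)" for n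
    using c by (subst phi_eq) auto
  have "(\<lambda>n. \<integral>s. (1 - exp (- (real (Suc n) * c) * s)) / (real (Suc n) * c) \<partial>\<mu>) \<longlonglongrightarrow> (\<integral>s. 0 \<partial>\<mu>)"
  proof (rule integral_dominated_convergence[where w = "\<lambda>s. max 1 (1 / c) * min 1 s"])
    show "AE s in \<mu>. (\<lambda>n. (1 - exp (- (real (Suc n) * c) * s)) / (real (Suc n) * c)) \<longlonglongrightarrow> 0"
    proof (rule AE_I2)
      fix s assume "s \<in> space \<mu>"
      then have s: "0 < s" by (simp add: space_levy)
      show "(\<lambda>n. (1 - exp (- (real (Suc n) * c) * s)) / (real (Suc n) * c)) \<longlonglongrightarrow> 0"
      proof (rule Lim_null_comparison)
        have "norm ((1 - exp (- (real (Suc n) * c) * s)) / (real (Suc n) * c)) \<le> 1 / (real (Suc n) * c)" for n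
        proof -
          have "0 < real (Suc n) * c" using c by simp
          then show ?thesis using s unfolding real_norm_def abs_divide by (intro frac_le) auto
        qed
        then show "\<forall>\<^sub>F n in sequentially.
            norm ((1 - exp (- (real (Suc n) * c) * s)) / (real (Suc n) * c)) \<le> 1 / (real (Suc n) * c)" by simp
        show "(\<lambda>n. 1 / (real (Suc n) * c)) \<longlonglongrightarrow> 0" using c by real_asymp
      qed
    qed
    show "AE s in \<mu>. norm ((1 - exp (- (real (Suc n) * c) * s)) / (real (Suc n) * c)) \<le> max 1 (1 / c) * min 1 s" for n
    proof (rule AE_I2)
      fix s assume "s \<in> space \<mu>"
      then have s: "0 < s" by (simp add: space_levy)
      define l where "l = real (Suc n) * c"
      have l: "c \<le> l" using c by (simp add: l_def)
      have "(1 - exp (- l * s)) / l \<le> max 1 l * min 1 s / l"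
        using one_minus_exp_le_min[of l s] c l s by (intro divide_right_mono) auto
      also have "\<dots> = max 1 l / l * min 1 s" by simp
      also have "\<dots> \<le> max 1 (1 / c) * min 1 s"
        using s c l by (intro mult_right_mono) (auto simp: max_def field_simps)
      finally have "(1 - exp (- l * s)) / l \<le> max 1 (1 / c) * min 1 s" .
      moreover have "0 \<le> (1 - exp (- l * s)) / l" using s c l by auto
      ultimately show "norm ((1 - exp (- (real (Suc n) * c) * s)) / (real (Suc n) * c)) \<le> max 1 (1 / c) * min 1 s"
        by (simp only: l_def real_norm_def abs_of_nonneg)
    qed
  qed (use c in \<open>auto intro!: measurable_levy integrable_mult_right integrable_min\<close>)
  then show ?thesis unfolding eq by simp
qed

lemma phi_over_has_derivative:
  assumes "0 < y"
  shows "((\<lambda>y. \<phi> y / y) has_real_derivative - H y / y\<^sup>2) (at y)"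
proof -
  have "((\<lambda>y. \<phi> y / y) has_real_derivative (deriv \<phi> y * y - \<phi> y * 1) / (y * y)) (at y)"
    using assms by (intro DERIV_divide phi_has_derivative DERIV_ident) auto
  then show ?thesis by (simp add: H_of_def power2_eq_square mult.commute)
qed

text \<open>\<open>\<phi>(\<lambda>)/\<lambda>\<close> has derivative \<open>-H(\<lambda>)/\<lambda>\<^sup>2\<close> and vanishes at infinity because there is no drift,
  so inequalities between values of \<open>H\<close> integrate to inequalities between values of \<open>\<phi>\<close>.\<close>

lemma scaling_L_phi:
  assumes "scaling_L H \<gamma> lamL C"
  shows "scaling_L \<phi> \<gamma> lamL C"
proof -
  from assms have Hpos: "\<And>l. 0 < l \<Longrightarrow> 0 < H l" and par: "0 < \<gamma>" "0 \<le> lamL" "0 < C"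
    and sc: "\<And>l x. lamL < l \<Longrightarrow> 1 \<le> x \<Longrightarrow> C * x powr \<gamma> \<le> H (l * x) / H l"
    by (auto simp: scaling_L_def)
  have pos: "0 < \<phi> l" if "0 < l" for l using Hpos[OF that] H_le_phi[OF that] by simp
  have "C * x powr \<gamma> \<le> \<phi> (l * x) / \<phi> l" if l: "lamL < l" and x: "1 \<le> x" for l x
  proof -
    have l0: "0 < l" using l par by simp
    \<comment> \<open>The claim is G l \<ge> 0 up to a factor. By (L) for H, G is nonincreasing on
      [l, \<infinity>), and it tends to 0.\<close>
    define G where "G y = \<phi> (y * x) / (y * x) - C * x powr (\<gamma> - 1) * (\<phi> y / y)" for y
    have G_deriv: "(G has_real_derivative ((C * x powr \<gamma> * H y - H (y * x)) / (y\<^sup>2 * x))) (at y)" if y: "l \<le> y" for y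
    proof -
      have y0: "0 < y" using l0 y by simp
      have "((\<lambda>y. \<phi> (y * x) / (y * x)) has_real_derivative - H (y * x) / (y * x)\<^sup>2 * x) (at y)"
        using y0 x DERIV_cmult_right[OF DERIV_ident, of x y UNIV]
        by (intro DERIV_chain2[where f = "\<lambda>z. \<phi> z / z"] phi_over_has_derivative) auto
      moreover have "((\<lambda>y. C * x powr (\<gamma> - 1) * (\<phi> y / y)) has_real_derivative
          C * x powr (\<gamma> - 1) * (- H y / y\<^sup>2)) (at y)"
        using y0 by (intro DERIV_cmult phi_over_has_derivative) auto
      ultimately have "(G has_real_derivative
          - H (y * x) / (y * x)\<^sup>2 * x - C * x powr (\<gamma> - 1) * (- H y / y\<^sup>2)) (at y)"
        unfolding G_def by (rule DERIV_diff)
      moreover have "- H (y * x) / (y * x)\<^sup>2 * x - C * x powr (\<gamma> - 1) * (- H y / y\<^sup>2)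
          = (C * x powr \<gamma> * H y - H (y * x)) / (y\<^sup>2 * x)"
        using y0 x by (simp add: powr_diff power2_eq_square divide_simps)
      ultimately show ?thesis by simp
    qed
    have G_mono: "G z \<le> G l" if "l \<le> z" for z
    proof (rule DERIV_nonpos_imp_nonincreasing[OF that])
      fix y assume y: "l \<le> y" "y \<le> z"
      have "C * x powr \<gamma> * H y \<le> H (y * x)"
        using sc[of y x] x l y Hpos[of y] l0 by (simp add: field_simps)
      then have "(C * x powr \<gamma> * H y - H (y * x)) / (y\<^sup>2 * x) \<le> 0"
        using x by (intro divide_nonpos_nonneg) auto
      then show "\<exists>D. (G has_real_derivative D) (at y) \<and> D \<le> 0" using G_deriv[OF y(1)] by blast
    qed
    have "(\<lambda>n. G (real (Suc n) * 1)) \<longlonglongrightarrow> 0 - C * x powr (\<gamma> - 1) * 0"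
      unfolding G_def using x phi_over_tendsto_0[of x]
      by (intro tendsto_intros phi_over_tendsto_0) auto
    moreover have "\<exists>N. \<forall>n\<ge>N. G (real (Suc n) * 1) \<le> G l"
    proof -
      obtain N where "l \<le> real N" using real_arch_simple by blast
      then show ?thesis using G_mono by (intro exI[of _ N]) auto
    qed
    ultimately have "0 - C * x powr (\<gamma> - 1) * 0 \<le> G l" by (rule LIMSEQ_le_const2)
    then have "C * x powr (\<gamma> - 1) * (\<phi> l / l) \<le> \<phi> (l * x) / (l * x)" by (simp add: G_def)
    then show ?thesis using x l0 pos[OF l0] by (simp add: powr_diff field_simps)
  qed
  then show ?thesis using par pos by (auto simp: scaling_L_def)
qed

end

section \<open>Heat kernel bounds\<close>

text \<open>Here p = d/2 and u = |x|^2, the only way in which the dimension and the point enter the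
  estimates.\<close>

definition heat_kernel :: "real \<Rightarrow> real \<Rightarrow> real \<Rightarrow> real" where
  "heat_kernel p u s = (4 * pi * s) powr (- p) * exp (- u / (4 * s))"

lemma heat_kernel_measurable [measurable]: "heat_kernel p u \<in> borel_measurable borel"
  unfolding heat_kernel_def by measurable

lemma heat_kernel_le:
  assumes "0 \<le> p" "0 < s"
  shows "heat_kernel p u s \<le> s powr (- p) * exp (- u / (4 * s))"
proof -
  have "1 * s \<le> 4 * pi * s" using assms pi_ge_two by (intro mult_right_mono) auto
  then have "(4 * pi * s) powr (- p) \<le> s powr (- p)" using assms by (intro powr_mono2') auto
  then show ?thesis by (simp add: heat_kernel_def mult_right_mono)
qed

lemma heat_kernel_ge:
  assumes p: "0 \<le> p" and u: "0 \<le> u" and s: "0 < \<alpha>" "\<alpha> \<le> s" "s \<le> \<beta>"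
  shows "(4 * pi * \<beta>) powr (- p) * exp (- u / (4 * \<alpha>)) \<le> heat_kernel p u s"
  unfolding heat_kernel_def
proof (rule mult_mono)
  show "(4 * pi * \<beta>) powr (- p) \<le> (4 * pi * s) powr (- p)" using p s by (intro powr_mono2') auto
  have "u / (4 * s) \<le> u / (4 * \<alpha>)" using u s by (intro divide_left_mono) auto
  then show "exp (- u / (4 * \<alpha>)) \<le> exp (- u / (4 * s))" by simp
qed auto

text \<open>Exponential decay is traded for a cube so that at y \<ge> 2^k the kernel gains 8^(-k),
  which beats the factor 4^k coming from \<open>H_scale\<close>.\<close>

lemma powr_exp_le_cube:
  fixes p y :: real
  assumes p: "0 \<le> p" and y: "1 \<le> y"
  shows "y powr p * exp (- (y / 4)) \<le> (4 * (p + 3)) powr (p + 3) / y ^ 3"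
proof -
  have "y powr (p + 3) \<le> ((p + 3) / (1 / 4)) powr (p + 3) * exp (1 / 4 * y)"
    using p y by (intro powr_le_exp) auto
  then have "y powr p * y ^ 3 \<le> (4 * (p + 3)) powr (p + 3) * exp (y / 4)"
    using y by (simp add: powr_add mult.commute powr_numeral)
  then show ?thesis using y by (simp add: exp_minus field_simps)
qed

lemma powr_large:
  fixes \<gamma> C m :: real
  assumes "0 < \<gamma>" "0 < C" "0 < m"
  obtains b where "2 \<le> b" "m \<le> C * b powr \<gamma>"
proof
  define b where "b = max 2 ((m / C) powr (1 / \<gamma>))"
  show "2 \<le> b" by (simp add: b_def)
  have "m / C = ((m / C) powr (1 / \<gamma>)) powr \<gamma>" using assms by (simp add: powr_powr)
  also have "\<dots> \<le> b powr \<gamma>" using assms by (intro powr_mono2) (auto simp: b_def)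
  finally show "m \<le> C * b powr \<gamma>" using assms by (simp add: field_simps)
qed

lemma suminf_geometric_ennreal:
  assumes "0 \<le> a"
  shows "(\<Sum>k. ennreal (a * (1 / 2) ^ k)) = ennreal (2 * a)"
proof (rule suminf_ennreal_eq)
  show "(\<lambda>k. a * (1 / 2) ^ k) sums (2 * a)"
    using sums_mult[OF geometric_sums[of "1 / 2 :: real"], of a] by (simp add: mult.commute)
qed (use assms in auto)

section \<open>Integrals of the kernel against the law of S t\<close>

context subordinator_laplace
begin

lemma emeasure_S: "0 \<le> t \<Longrightarrow> A \<in> sets borel \<Longrightarrow>
    (\<integral>\<^sup>+ \<omega>. indicator A (S t \<omega>) \<partial>M) = ennreal (prob {\<omega> \<in> space M. S t \<omega> \<in> A})"
proof -
  assume t: "0 \<le> t" and [measurable]: "A \<in> sets borel"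
  note [measurable] = S_measurable[OF t]
  have "(\<integral>\<^sup>+ \<omega>. indicator A (S t \<omega>) \<partial>M) = (\<integral>\<^sup>+ \<omega>. indicator {\<omega> \<in> space M. S t \<omega> \<in> A} \<omega> \<partial>M)"
    by (intro nn_integral_cong) (auto simp: indicator_def)
  then show ?thesis by (simp add: emeasure_eq_measure)
qed

text \<open>Common to the negative moment and to the off-diagonal upper bound: a function dominated
  by weights on dyadic events is integrated level by level.\<close>

lemma nn_integral_dyadic_le:
  assumes t: "0 \<le> t" and [measurable]: "\<And>k. A k \<in> sets borel" and a: "0 \<le> a" "\<And>k. 0 \<le> c k"
    and le: "\<And>k. c k * prob {\<omega> \<in> space M. S t \<omega> \<in> A k} \<le> a * (1 / 2) ^ k"
  shows "(\<integral>\<^sup>+ \<omega>. (\<Sum>k. ennreal (c k) * indicator (A k) (S t \<omega>)) \<partial>M) \<le> ennreal (2 * a)"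
proof -
  note [measurable] = S_measurable[OF t]
  have "(\<integral>\<^sup>+ \<omega>. (\<Sum>k. ennreal (c k) * indicator (A k) (S t \<omega>)) \<partial>M)
      = (\<Sum>k. \<integral>\<^sup>+ \<omega>. ennreal (c k) * indicator (A k) (S t \<omega>) \<partial>M)"
    by (rule nn_integral_suminf) measurable
  also have "\<dots> = (\<Sum>k. ennreal (c k) * ennreal (prob {\<omega> \<in> space M. S t \<omega> \<in> A k}))"
    using t by (subst nn_integral_cmult) (auto simp: emeasure_S)
  also have "\<dots> \<le> (\<Sum>k. ennreal (a * (1 / 2) ^ k))"
    using le a by (intro suminf_le) (auto simp: ennreal_leI simp flip: ennreal_mult)
  also have "\<dots> = ennreal (2 * a)" using a(1) by (rule suminf_geometric_ennreal)
  finally show ?thesis .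
qed

lemma le_suminf_ennreal: "f k \<le> (\<Sum>k. f k)" for f :: "nat \<Rightarrow> ennreal"
  using sum_le_suminf[of f "{k}"] by simp

lemma transition_density_eq:
  assumes "0 \<le> t"
  shows "transition_density M S t (x :: real ^ 'd)
    = (\<integral>\<^sup>+ \<omega>. ennreal (heat_kernel (real CARD('d) / 2) ((norm x)\<^sup>2) (S t \<omega>)) * indicator {0<..} (S t \<omega>) \<partial>M)"
proof -
  note [measurable] = S_measurable[OF assms]
  show ?thesis
    unfolding transition_density_def
    by (subst nn_integral_distr) (auto simp: heat_kernel_def)
qed

text \<open>Both lower bounds on the density come from here: the Gaussian one with A around 1/r, the
  jump one with A of the form [u, const u).\<close>

lemma density_ge:
  assumes t: "0 \<le> t" and p: "0 \<le> p" and u: "0 \<le> u" and \<alpha>: "0 < \<alpha>"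
    and A [measurable]: "A \<in> sets borel" and sub: "A \<subseteq> {\<alpha>..\<beta>}" 
    and q: "0 \<le> q" "q \<le> prob {\<omega> \<in> space M. S t \<omega> \<in> A}"
  shows "ennreal ((4 * pi * \<beta>) powr (- p) * exp (- u / (4 * \<alpha>)) * q)
    \<le> (\<integral>\<^sup>+ \<omega>. ennreal (heat_kernel p u (S t \<omega>)) * indicator {0<..} (S t \<omega>) \<partial>M)"
proof -
  note [measurable] = S_measurable[OF t]
  define c where "c = (4 * pi * \<beta>) powr (- p) * exp (- u / (4 * \<alpha>))"
  have c: "0 \<le> c" by (simp add: c_def)
  have "ennreal (c * q) \<le> ennreal c * ennreal (prob {\<omega> \<in> space M. S t \<omega> \<in> A})"
    using q c by (auto simp: ennreal_leI mult_left_mono simp flip: ennreal_mult)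
  also have "\<dots> = (\<integral>\<^sup>+ \<omega>. ennreal c * indicator A (S t \<omega>) \<partial>M)"
    using t by (subst nn_integral_cmult) (auto simp: emeasure_S)
  also have "\<dots> \<le> (\<integral>\<^sup>+ \<omega>. ennreal (heat_kernel p u (S t \<omega>)) * indicator {0<..} (S t \<omega>) \<partial>M)"
  proof (rule nn_integral_mono)
    fix \<omega> assume "\<omega> \<in> space M"
    show "ennreal c * indicator A (S t \<omega>) \<le> ennreal (heat_kernel p u (S t \<omega>)) * indicator {0<..} (S t \<omega>)"
    proof (cases "S t \<omega> \<in> A")
      case True
      then have "\<alpha> \<le> S t \<omega>" "S t \<omega> \<le> \<beta>" using sub by auto
      then show ?thesis using heat_kernel_ge[OF p u \<alpha>, of "S t \<omega>" \<beta>] \<alpha> True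
        by (simp add: c_def ennreal_leI)
    qed simp
  qed
  finally show ?thesis by (simp add: c_def)
qed

end

section \<open>The inverse of \<phi>, the mass near 1/r and the Gaussian term\<close>

context driftless_subordinator
begin

text \<open>Origin of \<kappa> = 1/b. Otherwise 1 = t \<phi>(r) \<le> t \<phi>(b
  \<open>lamL\<close>) \<le> b t \<phi>(\<open>lamL\<close>) < 1, by
  \<open>phi_scale\<close>.\<close>

lemma less_of_time_bound:
  assumes "0 < t" "0 < r" "1 \<le> b" "0 \<le> lamL" "t * \<phi> r = 1" "t * \<phi> lamL < 1 / b"
  shows "b * lamL < r"
proof (rule ccontr)
  assume *: "\<not> b * lamL < r"
  have "lamL \<noteq> 0" using * assms(2) by (intro notI) simp
  then have l: "0 < lamL" using assms(4) by simp
  have "\<phi> r \<le> \<phi> (b * lamL)" using * assms by (intro phi_mono) auto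
  also have "\<dots> \<le> b * \<phi> lamL" using assms l by (intro phi_scale) auto
  finally have "t * \<phi> r \<le> t * (b * \<phi> lamL)" using assms by (intro mult_left_mono) auto
  then show False using assms by (simp add: field_simps)
qed

text \<open>\<open>inv_into\<close> is meaningful only on the image, so surjectivity onto the
  positive reals has to be shown: \<phi> is continuous, small near 0, and driven above y by scaling
  (L).\<close>

lemma phi_inv:
  assumes sc: "scaling_L \<phi> \<gamma> lamL C" and y: "0 < y"
  shows "0 < phi_inv \<phi> y" "\<phi> (phi_inv \<phi> y) = y"
proof -
  obtain n where n: "\<phi> (1 / Suc n) < y"
    using order_tendstoD(2)[OF phi_tendsto_0 y] unfolding eventually_sequentially by blast
  \<comment> \<open>Scaling is available only strictly above \<open>lamL\<close>.\<close>
  define l where "l = lamL + 1"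
  have l: "lamL < l" "0 < l" "0 < \<phi> l" using sc by (auto simp: l_def scaling_L_def add_nonneg_pos)
  obtain b where b: "2 \<le> b" "y \<le> C * \<phi> l * b powr \<gamma>"
    using powr_large[of \<gamma> "C * \<phi> l" y] sc y l by (auto simp: scaling_L_def)
  have "C * b powr \<gamma> \<le> \<phi> (l * b) / \<phi> l" using sc b l by (auto simp: scaling_L_def)
  then have yb: "y \<le> \<phi> (l * b)" using b l by (simp add: field_simps)
  have "1 / Suc n \<le> l * b"
  proof (rule ccontr)
    assume "\<not> 1 / Suc n \<le> l * b"
    then have "\<phi> (l * b) \<le> \<phi> (1 / Suc n)" using l b by (intro phi_mono) auto
    then show False using yb n by linarith
  qed
  moreover have "continuous_on {1 / Suc n..l * b} \<phi>"
    by (intro continuous_at_imp_continuous_on ballI DERIV_isCont[OF phi_has_derivative])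
       (auto simp: less_le_trans[rotated])
  ultimately obtain z where "1 / Suc n \<le> z" "\<phi> z = y"
    using IVT'[of \<phi> "1 / Suc n" y "l * b"] n yb by force
  then have "y \<in> \<phi> ` {0<..}"
    by (intro image_eqI[of _ _ z]) (auto intro: less_le_trans[rotated])
  then show "0 < phi_inv \<phi> y" "\<phi> (phi_inv \<phi> y) = y"
    unfolding phi_inv_def using inv_into_into[of y \<phi> "{0<..}"] by (auto simp: f_inv_into_f)
qed

text \<open>The number 8 makes both tails at most 1/4: P(S_t \<ge> b/r) \<le> 2 t \<phi>(r/b) \<le>
  2/8, and P(S_t \<le> 1/(br)) \<le> e^(1-8).\<close>

lemma central_mass:
  assumes sc: "scaling_L \<phi> \<gamma> lamL C" and b: "2 \<le> b" "8 \<le> C * b powr \<gamma>"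
    and t: "0 < t" and r: "0 < r" "t * \<phi> r = 1" and small: "t * \<phi> lamL < 1 / b"
  shows "1 / 2 \<le> prob {\<omega> \<in> space M. S t \<omega> \<in> {1 / (b * r)<..<b / r}}"
proof -
  note [measurable] = S_measurable[OF less_imp_le[OF t]]
  have pos: "\<And>l. 0 < l \<Longrightarrow> 0 < \<phi> l" and lamL: "0 \<le> lamL" and C: "0 < C"
    and sc': "\<And>l x. lamL < l \<Longrightarrow> 1 \<le> x \<Longrightarrow> C * x powr \<gamma> \<le> \<phi> (l * x) / \<phi> l"
    using sc by (auto simp: scaling_L_def)
  have br: "b * lamL < r" using less_of_time_bound[OF t r(1) _ lamL r(2) small] b by simp
  have "lamL \<le> b * lamL" using b lamL by (simp add: mult_le_cancel_right1)
  then have r_lamL: "lamL < r" using br by linarith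
  have "prob {\<omega> \<in> space M. b / r \<le> S t \<omega>} \<le> 2 * (t * \<phi> (1 / (b / r)))"
    using t b r by (intro prob_ge_le_phi) auto
  also have "\<dots> \<le> 1 / 4"
  proof -
    have "8 \<le> \<phi> (r / b * b) / \<phi> (r / b)"
      using sc'[of "r / b" b] b br by (simp add: field_simps)
    then have "8 * \<phi> (r / b) \<le> \<phi> r" using pos[of "r / b"] b r by (simp add: field_simps)
    then have "t * (8 * \<phi> (r / b)) \<le> t * \<phi> r" using t by (intro mult_left_mono) auto
    then show ?thesis using r by simp
  qed
  finally have up: "prob {\<omega> \<in> space M. b / r \<le> S t \<omega>} \<le> 1 / 4" .
  have "prob {\<omega> \<in> space M. S t \<omega> \<le> 1 / (b * r)} \<le> exp (1 - t * \<phi> (1 / (1 / (b * r))))"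
    using t b r by (intro prob_le_le_phi) auto
  also have "\<dots> \<le> exp (- 2)"
  proof -
    have "8 \<le> \<phi> (r * b) / \<phi> r" using sc'[OF r_lamL, of b] b by simp
    then have "8 * \<phi> r \<le> \<phi> (r * b)" using pos[OF r(1)] by (simp add: field_simps)
    then have "t * (8 * \<phi> r) \<le> t * \<phi> (r * b)" using t by (intro mult_left_mono) auto
    then show ?thesis using r by (simp add: mult.commute)
  qed
  also have "\<dots> \<le> 1 / 4"
    using power_mono[of 2 "exp 1 :: real" 2] exp_ge_add_one_self[of "1::real"]
    by (simp add: exp_minus field_simps flip: exp_of_nat_mult)
  finally have low: "prob {\<omega> \<in> space M. S t \<omega> \<le> 1 / (b * r)} \<le> 1 / 4" .
  have "1 = prob (space M)" by (simp add: prob_space)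
  also have "\<dots> \<le> prob ({\<omega> \<in> space M. S t \<omega> \<in> {1 / (b * r)<..<b / r}} \<union>
      ({\<omega> \<in> space M. b / r \<le> S t \<omega>} \<union> {\<omega> \<in> space M. S t \<omega> \<le> 1 / (b * r)}))"
    by (intro finite_measure_mono) auto
  also have "\<dots> \<le> prob {\<omega> \<in> space M. S t \<omega> \<in> {1 / (b * r)<..<b / r}} +
      (prob {\<omega> \<in> space M. b / r \<le> S t \<omega>} + prob {\<omega> \<in> space M. S t \<omega> \<le> 1 / (b * r)})"
    by (intro order_trans[OF measure_Un_le] add_left_mono measure_Un_le) auto
  finally show ?thesis using up low by linarith
qed

text \<open>On the central event the kernel is smallest for time b/r in the power and 1/(br) in the
  exponential; the latter gives the rate b/4, the later a_L.\<close>

lemma gaussian_lower_bound: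
  assumes sc: "scaling_L \<phi> \<gamma> lamL C" and b: "2 \<le> b" "8 \<le> C * b powr \<gamma>"
    and t: "0 < t" and r: "0 < r" "t * \<phi> r = 1" and small: "t * \<phi> lamL < 1 / b"
    and p: "0 \<le> p" and u: "0 \<le> u"
  shows "ennreal ((4 * pi * b) powr (- p) / 2 * (r powr p * exp (- (b / 4) * u * r)))
    \<le> (\<integral>\<^sup>+ \<omega>. ennreal (heat_kernel p u (S t \<omega>)) * indicator {0<..} (S t \<omega>) \<partial>M)"
proof -
  have "(4 * pi * (b / r)) powr (- p) = (4 * pi * b) powr (- p) * r powr p"
    using b r by (simp add: powr_minus powr_divide powr_mult field_simps)
  moreover have "- u / (4 * (1 / (b * r))) = - (b / 4) * u * r" by simp
  moreover have "ennreal ((4 * pi * (b / r)) powr (- p) * exp (- u / (4 * (1 / (b * r)))) * (1 / 2))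
    \<le> (\<integral>\<^sup>+ \<omega>. ennreal (heat_kernel p u (S t \<omega>)) * indicator {0<..} (S t \<omega>) \<partial>M)"
    using assms central_mass[OF sc b t r small]
    by (intro density_ge[where A = "{1 / (b * r)<..<b / r}"]) auto
  ultimately show ?thesis by (simp add: mult_ac)
qed

text \<open>At level s of order 2^(-k)/r the integrand is about r^p 2^(kp), whereas the probability
  is at most e^(1 - C 2^(k\<gamma>)) and decays faster than any power of 2^k. The constant D is
  uniform in t and r.\<close>

lemma nn_integral_powr_le:
  assumes sc: "scaling_L \<phi> \<gamma> lamL C" and p: "0 < p"
  obtains D where "0 < D"
    "\<And>t r. 0 < t \<Longrightarrow> lamL < r \<Longrightarrow> t * \<phi> r = 1 \<Longrightarrow>
      (\<integral>\<^sup>+ \<omega>. ennreal (S t \<omega> powr (- p)) * indicator {0<..} (S t \<omega>) \<partial>M) \<le> ennreal (D * r powr p)"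
proof
  have \<gamma>: "0 < \<gamma>" and lamL: "0 \<le> lamL" and C: "0 < C" and pos: "\<And>l. 0 < l \<Longrightarrow> 0 < \<phi> l"
    and sc': "\<And>l x. lamL < l \<Longrightarrow> 1 \<le> x \<Longrightarrow> C * x powr \<gamma> \<le> \<phi> (l * x) / \<phi> l"
    using sc by (auto simp: scaling_L_def)
  \<comment> \<open>Chosen so that (z^\<gamma>)^m = z^(p+1): one power of z = 2^k beyond the weight,
    leaving 2^(-k) to sum.\<close>
  define m where "m = (p + 1) / \<gamma>"
  have m: "0 < m" using p \<gamma> by (simp add: m_def)
  define E where "E = exp 1 * (m / C) powr m * 2 powr p"
  show "0 < 1 + 2 * E" by (simp add: E_def add_pos_nonneg)
  fix t r :: real
  assume t: "0 < t" and r_lamL: "lamL < r" and r1: "t * \<phi> r = 1"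
  have r: "0 < r" using r_lamL lamL by simp
  note [measurable] = S_measurable[OF less_imp_le[OF t]]
  \<comment> \<open>The value of s^(-p) at the lower end of the k-th dyadic shell below 1/r; the
    event \<open>A k\<close> is the whole region below the upper end.\<close>
  define c where "c k = r powr p * (2 ^ Suc k) powr p" for k :: nat
  define A where "A k = {..1 / r / 2 ^ k}" for k :: nat
  have "(\<integral>\<^sup>+ \<omega>. ennreal (S t \<omega> powr (- p)) * indicator {0<..} (S t \<omega>) \<partial>M)
      \<le> (\<integral>\<^sup>+ \<omega>. ennreal (r powr p) + (\<Sum>k. ennreal (c k) * indicator (A k) (S t \<omega>)) \<partial>M)"
  proof (rule nn_integral_mono)
    fix \<omega>
    define s where "s = S t \<omega>"
    have "ennreal (s powr (- p)) * indicator {0<..} s \<le> ennreal (r powr p) + (\<Sum>k. ennreal (c k) * indicator (A k) s)"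
    proof (cases "0 < s")
      case s: True
      show ?thesis
      proof (cases "s \<le> 1 / r")
        case True
        from s True obtain k where k: "1 / r / 2 ^ Suc k < s" "s \<le> 1 / r / 2 ^ k" by (rule dyadic_level)
        have "s powr (- p) \<le> (1 / r / 2 ^ Suc k) powr (- p)"
          using k p r by (intro powr_mono2') auto
        also have "\<dots> = c k"
          using r by (simp add: c_def powr_minus powr_divide powr_mult field_simps)
        finally have "ennreal (s powr (- p)) * indicator {0<..} s \<le> ennreal (c k) * indicator (A k) s"
          using s k by (simp add: A_def ennreal_leI)
        also have "\<dots> \<le> (\<Sum>k. ennreal (c k) * indicator (A k) s)" by (rule le_suminf_ennreal)
        finally show ?thesis by (simp add: add_increasing)
      next
        case False
        then have "s powr (- p) \<le> (1 / r) powr (- p)" using p r by (intro powr_mono2') auto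
        also have "\<dots> = r powr p" using r by (simp add: powr_minus powr_divide field_simps)
        finally show ?thesis using s by (simp add: add_increasing2 ennreal_leI)
      qed
    qed simp
    then show "ennreal (S t \<omega> powr (- p)) * indicator {0<..} (S t \<omega>)
        \<le> ennreal (r powr p) + (\<Sum>k. ennreal (c k) * indicator (A k) (S t \<omega>))"
      by (simp add: s_def)
  qed
  also have "\<dots> = ennreal (r powr p) + (\<integral>\<^sup>+ \<omega>. (\<Sum>k. ennreal (c k) * indicator (A k) (S t \<omega>)) \<partial>M)"
    by (subst nn_integral_add) (auto simp: A_def emeasure_space_1)
  also have "\<dots> \<le> ennreal (r powr p) + ennreal (2 * (r powr p * E))"
  proof (intro add_left_mono nn_integral_dyadic_le)
    fix k :: nat
    define z :: real where "z = 2 ^ k"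
    have z: "1 \<le> z" by (simp add: z_def)
    define y where "y = z powr \<gamma>"
    have y: "0 < y" using z by (simp add: y_def)
    have "prob {\<omega> \<in> space M. S t \<omega> \<in> A k} \<le> exp (1 - t * \<phi> (1 / (1 / r / z)))"
      using t r z prob_le_le_phi[of t "1 / r / z"] by (simp add: A_def z_def)
    also have "\<dots> \<le> exp (1 - C * y)"
    proof -
      have "C * y * \<phi> r \<le> \<phi> (r * z)"
        using sc'[OF r_lamL z] pos[OF r] by (simp add: y_def field_simps)
      then have "t * (C * y * \<phi> r) \<le> t * \<phi> (r * z)" using t by (intro mult_left_mono) auto
      moreover have "t * (C * y * \<phi> r) = C * y" using r1 by (simp add: mult_ac)
      ultimately show ?thesis by simp
    qed
    also have "\<dots> \<le> exp 1 * ((m / C) powr m / y powr m)"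
    proof -
      have "exp (- (C * y)) \<le> (m / C) powr m / y powr m"
        using powr_le_exp[OF m C y] y by (simp add: exp_minus field_simps)
      then show ?thesis by (simp add: exp_diff exp_minus divide_inverse)
    qed
    also have "y powr m = z powr p * z"
      using z \<gamma> by (simp add: y_def powr_powr m_def powr_add)
    finally have "c k * prob {\<omega> \<in> space M. S t \<omega> \<in> A k}
        \<le> c k * (exp 1 * ((m / C) powr m / (z powr p * z)))"
      by (intro mult_left_mono) (auto simp: c_def)
    also have "\<dots> = r powr p * E * (1 / 2) ^ k"
    proof -
      have "c k = r powr p * (2 powr p * z powr p)" using z by (simp add: c_def z_def powr_mult)
      moreover have "(1 / 2) ^ k = 1 / z" by (simp add: z_def power_divide)
      ultimately show ?thesis using z by (simp add: E_def)
    qed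
    finally show "c k * prob {\<omega> \<in> space M. S t \<omega> \<in> A k} \<le> r powr p * E * (1 / 2) ^ k" .
  qed (use t in \<open>auto simp: A_def c_def E_def\<close>)
  also have "\<dots> = ennreal ((1 + 2 * E) * r powr p)"
    by (simp add: E_def algebra_simps flip: ennreal_plus)
  finally show "(\<integral>\<^sup>+ \<omega>. ennreal (S t \<omega> powr (- p)) * indicator {0<..} (S t \<omega>) \<partial>M)
      \<le> ennreal ((1 + 2 * E) * r powr p)" .
qed

end

section \<open>The jump term\<close>

context driftless_subordinator
begin

text \<open>\<open>upper_tail\<close> with w = v/3. Its smallness condition follows from 1/w \<le>
  r/b and t \<phi>(r/b) \<le> 1/8; the 9 is the price of replacing H(3/v) by H(1/v).\<close>

lemma tail_beyond_inverse_scale: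
  assumes sc: "scaling_L \<phi> \<gamma> lamL C" and b: "2 \<le> b" "8 \<le> C * b powr \<gamma>"
    and t: "0 < t" and r: "0 < r" "t * \<phi> r = 1" and small: "t * \<phi> lamL < 1 / b"
    and H: "\<And>l. 0 < l \<Longrightarrow> 0 < H l" and v: "3 * b / r \<le> v"
  shows "prob {\<omega> \<in> space M. v \<le> S t \<omega>} \<le> 9 * (6 + exp 6) * (t * H (1 / v))"
proof -
  have pos: "\<And>l. 0 < l \<Longrightarrow> 0 < \<phi> l" and lamL: "0 \<le> lamL"
    and sc': "\<And>l x. lamL < l \<Longrightarrow> 1 \<le> x \<Longrightarrow> C * x powr \<gamma> \<le> \<phi> (l * x) / \<phi> l"
    using sc by (auto simp: scaling_L_def)
  have br: "b * lamL < r" using less_of_time_bound[OF t r(1) _ lamL r(2) small] b by simp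
  define w where "w = v / 3"
  have "0 < 3 * b / r" using b r by simp
  then have v0: "0 < v" using v by linarith
  have w: "0 < w" "1 / w \<le> r / b" using v0 v b r by (auto simp: w_def field_simps)
  have "8 \<le> \<phi> (r / b * b) / \<phi> (r / b)"
    using sc'[of "r / b" b] b br by (simp add: field_simps)
  then have "8 * \<phi> (r / b) \<le> \<phi> r" using pos[of "r / b"] b r by (simp add: field_simps)
  moreover have "\<phi> (1 / w) \<le> \<phi> (r / b)" using w by (intro phi_mono) auto
  ultimately have "8 * \<phi> (1 / w) \<le> \<phi> r" by linarith
  then have "t * (8 * \<phi> (1 / w)) \<le> t * \<phi> r" using t by (intro mult_left_mono) auto
  moreover have "0 \<le> t * \<phi> (1 / w)" using t w pos[of "1 / w"] by simp
  ultimately have "3 * (t * \<phi> (1 / w)) \<le> 1" using r by simp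
  then have "prob {\<omega> \<in> space M. 3 * w \<le> S t \<omega>} \<le> (6 + exp 6) * (t * H (1 / w))"
    using t w H by (intro upper_tail) auto
  also have "\<dots> \<le> (6 + exp 6) * (t * (9 * H (1 / v)))"
    using H_scale[of 3 "1 / v"] v0 t by (intro mult_left_mono) (auto simp: w_def)
  finally show ?thesis by (simp add: w_def mult_ac)
qed

text \<open>The law of S_t is split at 3b/r. Below, e^(-u/(4s)) is at most e^(-ur/(12b)), which
  comes out of the integral and leaves the negative moment. Above, s is sorted into dyadic levels
  relative to u: the kernel gains 8^(-k) at level k while the tail bound loses only 4^k.\<close>

lemma density_le:
  assumes sc: "scaling_L \<phi> \<gamma> lamL C" and b: "2 \<le> b" "8 \<le> C * b powr \<gamma>"
    and t: "0 < t" and r: "0 < r" "t * \<phi> r = 1" and small: "t * \<phi> lamL < 1 / b"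
    and H: "\<And>l. 0 < l \<Longrightarrow> 0 < H l" and p: "0 < p" and u: "0 < u" and D: "0 \<le> D"
      "(\<integral>\<^sup>+ \<omega>. ennreal (S t \<omega> powr (- p)) * indicator {0<..} (S t \<omega>) \<partial>M) \<le> ennreal (D * r powr p)"
  shows "(\<integral>\<^sup>+ \<omega>. ennreal (heat_kernel p u (S t \<omega>)) * indicator {0<..} (S t \<omega>) \<partial>M)
    \<le> ennreal (D * (r powr p * exp (- (1 / (12 * b)) * u * r))
        + 72 * (6 + exp 6) * (4 * (p + 3)) powr (p + 3) * (t * u powr (- p) * H (1 / u)))"
proof -
  note [measurable] = S_measurable[OF less_imp_le[OF t]]
  define Q where "Q = (4 * (p + 3)) powr (p + 3)"
  have Q: "1 \<le> Q" unfolding Q_def using p by (intro ge_one_powr_ge_zero) auto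
  define T where "T = 9 * (6 + exp 6 :: real)"
  have T: "0 < T" by (simp add: T_def add_pos_pos)
  define e where "e = exp (- (1 / (12 * b)) * u * r)"
  define c where "c k = Q * u powr (- p) * (1 / 8) ^ k" for k :: nat
  \<comment> \<open>The maximum with 3b/r keeps every level inside the region where
    \<open>tail_beyond_inverse_scale\<close> applies.\<close>
  define A where "A k = {max (u / 2 ^ Suc k) (3 * b / r)..}" for k :: nat
  define G where "G s = ennreal (s powr (- p)) * indicator {0<..} s" for s :: real
  have [measurable]: "G \<in> borel_measurable borel" unfolding G_def by measurable
  have c: "0 \<le> c k" for k using Q by (simp add: c_def)
  have "(\<integral>\<^sup>+ \<omega>. ennreal (heat_kernel p u (S t \<omega>)) * indicator {0<..} (S t \<omega>) \<partial>M)
      \<le> (\<integral>\<^sup>+ \<omega>. ennreal e * G (S t \<omega>) + (\<Sum>k. ennreal (c k) * indicator (A k) (S t \<omega>)) \<partial>M)"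
  proof (rule nn_integral_mono)
    fix \<omega>
    define s where "s = S t \<omega>"
    have "ennreal (heat_kernel p u s) * indicator {0<..} s
        \<le> ennreal e * G s + (\<Sum>k. ennreal (c k) * indicator (A k) s)"
    proof (cases "0 < s")
      case s: True
      have hk: "heat_kernel p u s \<le> s powr (- p) * exp (- u / (4 * s))"
        using p s by (intro heat_kernel_le) auto
      show ?thesis
      proof (cases "s < 3 * b / r")
        case True
        then have "r * s \<le> 3 * b" using r by (simp add: field_simps)
        then have "u * (r * s) \<le> u * (3 * b)" using u by (intro mult_left_mono) auto
        then have "exp (- u / (4 * s)) \<le> e" using b s by (simp add: e_def field_simps)
        then have "heat_kernel p u s \<le> e * s powr (- p)"
          using hk mult_left_mono[of "exp (- u / (4 * s))" e "s powr (- p)"] by (simp add: mult.commute)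
        then have "ennreal (heat_kernel p u s) * indicator {0<..} s \<le> ennreal e * G s"
          using s by (simp add: G_def e_def ennreal_leI flip: ennreal_mult)
        then show ?thesis by (simp add: add_increasing2)
      next
        case large: False
        \<comment> \<open>Level 0 also covers s \<ge> u, where the kernel is at most u^(-p).\<close>
        have "\<exists>k. heat_kernel p u s \<le> c k \<and> u / 2 ^ Suc k \<le> s"
        proof (cases "u \<le> s")
          case True
          have "s powr (- p) * exp (- u / (4 * s)) \<le> u powr (- p) * 1"
            using True u s p by (intro mult_mono powr_mono2') auto
          also have "\<dots> \<le> c 0" using mult_right_mono[OF Q, of "u powr (- p)"] by (simp add: c_def)
          finally show ?thesis using hk True u by (intro exI[of _ 0]) auto
        next
          case False
          then obtain k where k: "u / 2 ^ Suc k < s" "s \<le> u / 2 ^ k" using dyadic_level[of s u] s by auto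
          define y where "y = u / s"
          have y: "2 ^ k \<le> y" "1 \<le> y" "u = s * y" using k s False by (auto simp: y_def field_simps)
          have "s powr (- p) * exp (- u / (4 * s)) = u powr (- p) * (y powr p * exp (- (y / 4)))"
            using s y by (simp add: powr_mult powr_minus field_simps)
          also have "\<dots> \<le> u powr (- p) * (Q / y ^ 3)"
            unfolding Q_def using p y by (intro mult_left_mono powr_exp_le_cube) auto
          also have "\<dots> \<le> u powr (- p) * (Q / (2 ^ k) ^ 3)"
            using Q y by (intro mult_left_mono divide_left_mono power_mono) auto
          also have "(2 ^ k) ^ 3 = (2 ^ 3 :: real) ^ k" by (simp only: mult.commute flip: power_mult)
          finally have "s powr (- p) * exp (- u / (4 * s)) \<le> c k"
            by (simp add: c_def power_divide mult_ac)
          then show ?thesis using hk k by (intro exI[of _ k]) auto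
        qed
        then obtain k where k: "heat_kernel p u s \<le> c k" "u / 2 ^ Suc k \<le> s" by blast
        then have "ennreal (heat_kernel p u s) * indicator {0<..} s \<le> ennreal (c k) * indicator (A k) s"
          using s large by (simp add: A_def ennreal_leI)
        also have "\<dots> \<le> (\<Sum>k. ennreal (c k) * indicator (A k) s)" by (rule le_suminf_ennreal)
        finally show ?thesis by (simp add: add_increasing)
      qed
    qed simp
    then show "ennreal (heat_kernel p u (S t \<omega>)) * indicator {0<..} (S t \<omega>)
        \<le> ennreal e * G (S t \<omega>) + (\<Sum>k. ennreal (c k) * indicator (A k) (S t \<omega>))"
      by (simp add: s_def)
  qed
  also have "\<dots> = ennreal e * (\<integral>\<^sup>+ \<omega>. G (S t \<omega>) \<partial>M) + (\<integral>\<^sup>+ \<omega>. (\<Sum>k. ennreal (c k) * indicator (A k) (S t \<omega>)) \<partial>M)"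
    by (subst nn_integral_add) (auto simp: A_def nn_integral_cmult)
  \<comment> \<open>The final 72 is 2 * 4 * 9: the geometric sum, the square of the extra factor 2
    in 2^(k+1), and the 9 contained in T.\<close>
  also have "\<dots> \<le> ennreal e * ennreal (D * r powr p)
      + ennreal (2 * (Q * u powr (- p) * (4 * T * (t * H (1 / u)))))"
  proof (intro add_mono mult_left_mono nn_integral_dyadic_le)
    show "(\<integral>\<^sup>+ \<omega>. G (S t \<omega>) \<partial>M) \<le> ennreal (D * r powr p)" using D by (simp add: G_def)
    fix k :: nat
    define a where "a = u / 2 ^ Suc k"
    have a: "0 < a" using u by (simp add: a_def)
    have "prob {\<omega> \<in> space M. S t \<omega> \<in> A k} \<le> T * (t * H (1 / max a (3 * b / r)))"
      using tail_beyond_inverse_scale[OF sc b t r small H, of "max a (3 * b / r)"]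
      by (simp only: A_def a_def T_def atLeast_iff max.cobounded2)
    also have "\<dots> \<le> T * (t * H (1 / a))"
    proof -
      have "1 / max a (3 * b / r) \<le> 1 / a" using a by (intro divide_left_mono) auto
      moreover have "0 < 1 / max a (3 * b / r)" using a by (simp add: less_max_iff_disj)
      ultimately show ?thesis using T t by (intro mult_left_mono H_mono) auto
    qed
    also have "\<dots> \<le> T * (t * (4 * 4 ^ k * H (1 / u)))"
    proof -
      have "(2 ^ k)\<^sup>2 = (2\<^sup>2 :: real) ^ k" by (simp only: mult.commute flip: power_mult)
      then have "(2 ^ Suc k)\<^sup>2 = (4 * 4 ^ k :: real)" by (simp add: power_mult_distrib)
      moreover have "(1 :: real) \<le> 2 ^ Suc k" by (rule one_le_power) simp
      ultimately have "H (1 / a) \<le> 4 * 4 ^ k * H (1 / u)"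
        using H_scale[of "2 ^ Suc k" "1 / u"] u by (simp only: a_def) simp
      then show ?thesis using T t by (intro mult_left_mono) auto
    qed
    finally have "prob {\<omega> \<in> space M. S t \<omega> \<in> A k} \<le> T * (t * (4 * 4 ^ k * H (1 / u)))" .
    then have "c k * prob {\<omega> \<in> space M. S t \<omega> \<in> A k} \<le> c k * (T * (t * (4 * 4 ^ k * H (1 / u))))"
      using c by (rule mult_left_mono)
    also have "\<dots> = Q * u powr (- p) * (4 * T * (t * H (1 / u))) * ((1 / 8) ^ k * 4 ^ k)"
      by (simp add: c_def mult_ac)
    also have "(1 / 8) ^ k * 4 ^ k = (1 / 2 :: real) ^ k" by (simp only: power_mult_distrib[symmetric]) simp
    finally show "c k * prob {\<omega> \<in> space M. S t \<omega> \<in> A k}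
        \<le> Q * u powr (- p) * (4 * T * (t * H (1 / u))) * (1 / 2) ^ k" .
  qed (use t T Q c u H[of "1 / u"] in \<open>auto simp: A_def\<close>)
  also have "\<dots> = ennreal (e * (D * r powr p) + 2 * (Q * u powr (- p) * (4 * T * (t * H (1 / u)))))"
    using D t T Q u H[of "1 / u"] by (subst ennreal_plus) (auto simp: e_def ennreal_mult)
  also have "e * (D * r powr p) + 2 * (Q * u powr (- p) * (4 * T * (t * H (1 / u))))
    = D * (r powr p * e) + 72 * (6 + exp 6) * Q * (t * u powr (- p) * H (1 / u))"
    by (simp add: T_def algebra_simps)
  finally show ?thesis by (simp only: e_def Q_def)
qed

text \<open>Scaling (U) with \<open>\<delta> < 2\<close> makes the jumps of size at least \<open>u\<close> carry a fixed
  proportion of \<open>H(1/u)\<close>; scaling (L) keeps the mass beyond a large multiple of \<open>u\<close> small.\<close>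

lemma jump_lower_bound:
  assumes scL: "scaling_L H \<gamma> lamL C\<^sub>L" and scU: "scaling_U H \<delta> lamU C\<^sub>U" and \<delta>: "\<delta> < 2" and p: "0 \<le> p"
  obtains \<beta> K c where "1 < \<beta>" "1 < K" "0 < c"
    "\<And>t u. 0 < t \<Longrightarrow> 0 < u \<Longrightarrow> t * \<phi> (1 / u) \<le> 1 \<Longrightarrow> lamL * u < 1 / \<beta> \<Longrightarrow> lamU * u < 1 / K \<Longrightarrow>
      ennreal (c * (t * u powr (- p) * H (1 / u)))
        \<le> (\<integral>\<^sup>+ \<omega>. ennreal (heat_kernel p u (S t \<omega>)) * indicator {0<..} (S t \<omega>) \<partial>M)"
proof -
  have H: "\<And>l. 0 < l \<Longrightarrow> 0 < H l" and L: "0 < \<gamma>" "0 \<le> lamL" "0 < C\<^sub>L"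
    and scL': "\<And>l x. lamL < l \<Longrightarrow> 1 \<le> x \<Longrightarrow> C\<^sub>L * x powr \<gamma> \<le> H (l * x) / H l"
    using scL by (auto simp: scaling_L_def)
  have U: "0 < \<delta>" "0 \<le> lamU" "0 < C\<^sub>U"
    and scU': "\<And>l x. lamU < l \<Longrightarrow> 1 \<le> x \<Longrightarrow> H (l * x) / H l \<le> C\<^sub>U * x powr \<delta>"
    using scU by (auto simp: scaling_U_def)
  have scLphi: "\<And>l x. lamL < l \<Longrightarrow> 1 \<le> x \<Longrightarrow> C\<^sub>L * x powr \<gamma> \<le> \<phi> (l * x) / \<phi> l"
    using scaling_L_phi[OF scL] by (auto simp: scaling_L_def)
  have pos: "0 < \<phi> l" if "0 < l" for l using H[OF that] H_le_phi[OF that] by simp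
  have CU1: "1 \<le> C\<^sub>U" using scU'[of "lamU + 1" 1] H[of "lamU + 1"] U by simp
  \<comment> \<open>By (U), H(1/(Ku)) is at least 2 \<open>c0\<close> H(1/u), with \<open>c0\<close>
    of order K^(-\<delta>). Since \<delta> < 2, a large K makes the loss 3/K^2 in
    \<open>lower_tail\<close> at most \<open>c0\<close>, so half of the gain remains.\<close>
  obtain K where K: "2 \<le> K" "6 * C\<^sub>U \<le> 1 * K powr (2 - \<delta>)"
    using powr_large[of "2 - \<delta>" 1 "6 * C\<^sub>U"] \<delta> U by auto
  define c0 where "c0 = 1 / (2 * C\<^sub>U * K powr \<delta>)"
  have Kd: "1 \<le> K powr \<delta>" using K U by (intro ge_one_powr_ge_zero) auto
  have c0: "0 < c0" using U K by (simp add: c0_def)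
  have "1 \<le> 2 * C\<^sub>U * K powr \<delta>" using mult_mono[of 1 "2 * C\<^sub>U" 1 "K powr \<delta>"] CU1 Kd by simp
  then have c01: "c0 \<le> 1" by (simp add: c0_def)
  have K2: "3 / K\<^sup>2 \<le> c0"
  proof -
    have "6 * C\<^sub>U * K powr \<delta> \<le> K powr (2 - \<delta>) * K powr \<delta>" using K by (intro mult_right_mono) auto
    also have "\<dots> = K powr 2" by (simp only: powr_add[symmetric] diff_add_cancel)
    also have "\<dots> = K\<^sup>2" using K by simp
    finally show ?thesis using K U by (simp add: c0_def field_simps)
  qed
  define T where "T = (6 + exp 6 :: real)"
  have T: "6 \<le> T" by (simp add: T_def)
  \<comment> \<open>Makes the mass beyond 3\<beta>u at most half of the lower bound
    (\<open>c0\<close>/3) z for the mass beyond u. The same choice gives \<open>C\<^sub>L\<close>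
    \<beta>^\<gamma> \<ge> 3, hence the smallness condition of \<open>upper_tail\<close> at
    \<beta>u.\<close>
  obtain \<beta> where \<beta>: "2 \<le> \<beta>" "6 * T / c0 \<le> C\<^sub>L * \<beta> powr \<gamma>"
    using powr_large[of \<gamma> C\<^sub>L "6 * T / c0"] L T c0 by auto
  have "3 \<le> 6 * T / c0" using T c0 c01 by (simp add: field_simps)
  then have \<beta>3: "3 \<le> C\<^sub>L * \<beta> powr \<gamma>" using \<beta> by linarith
  define c where "c = (12 * pi * \<beta>) powr (- p) * exp (- (1 / 4)) * (c0 / 6)"
  show thesis
  proof (rule that[of \<beta> K c])
    show "1 < \<beta>" "1 < K" "0 < c" using \<beta> K c0 by (auto simp: c_def)
    fix t u :: real
    assume t: "0 < t" and u: "0 < u" and tphi: "t * \<phi> (1 / u) \<le> 1"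
      and uL: "lamL * u < 1 / \<beta>" and uU: "lamU * u < 1 / K"
    note [measurable] = S_measurable[OF less_imp_le[OF t]]
    have "H (1 / u) / H (1 / (K * u)) \<le> C\<^sub>U * K powr \<delta>"
      using scU'[of "1 / (K * u)" K] K u uU by (simp add: field_simps)
    then have "H (1 / u) \<le> C\<^sub>U * K powr \<delta> * H (1 / (K * u))"
      using H[of "1 / (K * u)"] K u by (simp add: field_simps)
    then have "2 * c0 * H (1 / u) \<le> H (1 / (K * u))"
      using U K by (simp add: c0_def field_simps)
    moreover have "3 / K\<^sup>2 * H (1 / u) \<le> c0 * H (1 / u)"
      using K2 H[of "1 / u"] u by (intro mult_right_mono) auto
    ultimately have "c0 * H (1 / u) \<le> H (1 / (K * u)) - 3 / K\<^sup>2 * H (1 / u)" by linarith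
    then have low: "1 - exp (- (c0 * (t * H (1 / u)))) \<le> prob {\<omega> \<in> space M. u \<le> S t \<omega>}"
      using K(1) by (intro lower_tail[OF t u, of K]) linarith+
    define z where "z = t * H (1 / u)"
    have z0: "0 \<le> z" using t u H[of "1 / u"] by (simp add: z_def)
    have "z \<le> t * \<phi> (1 / u)" unfolding z_def using t u by (intro mult_left_mono H_le_phi) auto
    then have z1: "z \<le> 1" using tphi by simp
    \<comment> \<open>The argument lies in [0,1] because H \<le> \<phi> and t \<phi>(1/u) \<le> 1,
      so 1 - e^(-y) may be replaced by y/3.\<close>
    have "c0 * z \<le> 3 * (1 - exp (- (c0 * z)))"
      using c0 c01 z0 z1 by (intro le_one_minus_exp) (auto simp: mult_le_one)
    then have low': "c0 / 3 * z \<le> prob {\<omega> \<in> space M. u \<le> S t \<omega>}" using low by (simp add: z_def)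
    have \<beta>u: "lamL < 1 / (\<beta> * u)" using uL \<beta> u by (simp add: field_simps)
    have "3 * \<phi> (1 / (\<beta> * u)) \<le> \<phi> (1 / u)"
    proof -
      have "3 \<le> \<phi> (1 / (\<beta> * u) * \<beta>) / \<phi> (1 / (\<beta> * u))"
        using scLphi[OF \<beta>u, of \<beta>] \<beta> \<beta>3 by simp
      then show ?thesis using pos[of "1 / (\<beta> * u)"] \<beta> u by (simp add: field_simps)
    qed
    then have "t * (3 * \<phi> (1 / (\<beta> * u))) \<le> t * \<phi> (1 / u)" using t by (intro mult_left_mono) auto
    then have "3 * (t * \<phi> (1 / (\<beta> * u))) \<le> 1" using tphi by simp
    moreover have \<beta>u0: "0 < \<beta> * u" using \<beta> u by simp
    moreover have "0 < H (1 / (\<beta> * u))" using \<beta>u0 by (intro H) simp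
    ultimately have "prob {\<omega> \<in> space M. 3 * (\<beta> * u) \<le> S t \<omega>} \<le> (6 + exp 6) * (t * H (1 / (\<beta> * u)))"
      by (intro upper_tail[OF t])
    also have "\<dots> \<le> c0 / 6 * z"
    proof -
      have "6 * T / c0 \<le> H (1 / (\<beta> * u) * \<beta>) / H (1 / (\<beta> * u))"
        using scL'[OF \<beta>u, of \<beta>] \<beta> by simp
      then have "T * H (1 / (\<beta> * u)) \<le> c0 / 6 * H (1 / u)"
        using H[of "1 / (\<beta> * u)"] \<beta> u c0 by (simp add: field_simps)
      then have "t * (T * H (1 / (\<beta> * u))) \<le> t * (c0 / 6 * H (1 / u))" using t by (intro mult_left_mono) auto
      then show ?thesis by (simp add: T_def z_def mult_ac)
    qed
    finally have up: "prob {\<omega> \<in> space M. 3 * (\<beta> * u) \<le> S t \<omega>} \<le> c0 / 6 * z" .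
    have "prob {\<omega> \<in> space M. u \<le> S t \<omega>} \<le> prob ({\<omega> \<in> space M. S t \<omega> \<in> {u..<3 * (\<beta> * u)}} \<union> {\<omega> \<in> space M. 3 * (\<beta> * u) \<le> S t \<omega>})"
      by (intro finite_measure_mono) auto
    also have "\<dots> \<le> prob {\<omega> \<in> space M. S t \<omega> \<in> {u..<3 * (\<beta> * u)}} + prob {\<omega> \<in> space M. 3 * (\<beta> * u) \<le> S t \<omega>}"
      by (intro measure_Un_le) auto
    finally have q: "c0 / 6 * z \<le> prob {\<omega> \<in> space M. S t \<omega> \<in> {u..<3 * (\<beta> * u)}}"
      using low' up by linarith
    have "ennreal ((4 * pi * (3 * (\<beta> * u))) powr (- p) * exp (- u / (4 * u)) * (c0 / 6 * z))
        \<le> (\<integral>\<^sup>+ \<omega>. ennreal (heat_kernel p u (S t \<omega>)) * indicator {0<..} (S t \<omega>) \<partial>M)"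
      using t p u q c0 z0 by (intro density_ge[where A = "{u..<3 * (\<beta> * u)}"]) auto
    moreover have "(4 * pi * (3 * (\<beta> * u))) powr (- p) = (12 * pi * \<beta>) powr (- p) * u powr (- p)"
      using \<beta> u powr_mult[of "12 * pi * \<beta>" u "- p"] by (simp add: mult.assoc)
    moreover have "exp (- u / (4 * u)) = exp (- (1 / 4))" using u by simp
    ultimately show "ennreal (c * (t * u powr (- p) * H (1 / u)))
        \<le> (\<integral>\<^sup>+ \<omega>. ennreal (heat_kernel p u (S t \<omega>)) * indicator {0<..} (S t \<omega>) \<partial>M)"
      by (simp only: c_def z_def mult_ac)
  qed
qed

end

text \<open>The product form absorbs the convention for inverse 0: if \<phi>(\<open>lamL\<close>) =
  0 the extended bound is vacuous and the real one reads 0 < \<kappa>.\<close>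

lemma time_rangeD:
  assumes "time_range \<phi> \<kappa> lamL t" "0 < \<kappa>" "0 \<le> \<phi> lamL"
  shows "0 < t" "t * \<phi> lamL < \<kappa>"
proof -
  show "0 < t" using assms by (simp add: time_range_def)
  show "t * \<phi> lamL < \<kappa>"
  proof (cases "\<phi> lamL = 0")
    case False
    then have "0 < \<phi> lamL" using assms by simp
    then show ?thesis using assms by (simp add: time_range_def field_simps)
  qed (use assms in simp)
qed

lemma norm_sq_less_of_ereal:
  assumes "ereal (norm x) < ereal \<theta> * inverse (ereal (sqrt l))" "0 < \<theta>" "0 \<le> l"
  shows "l * (norm x)\<^sup>2 < \<theta>\<^sup>2"
proof (cases "l = 0")
  case False
  then have "0 < sqrt l" using assms by simp
  then have "norm x * sqrt l < \<theta>" using assms by (simp add: field_simps)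
  then have "(norm x * sqrt l)\<^sup>2 < \<theta>\<^sup>2" using assms by (intro power_strict_mono) auto
  then show ?thesis using assms by (simp add: power_mult_distrib mult.commute)
next
  case True
  then show ?thesis using \<open>0 < \<theta>\<close> by simp
qed

lemma space_rangeD:
  assumes "space_range \<theta> lamL \<eta> lamU x" "0 < \<theta>" "0 < \<eta>" "0 \<le> lamL" "0 \<le> lamU"
  shows "lamL * (norm x)\<^sup>2 < \<theta>\<^sup>2" "lamU * (norm x)\<^sup>2 < \<eta>\<^sup>2"
  using assms by (auto simp: space_range_def intro!: norm_sq_less_of_ereal)

section \<open>Assembly of the two estimates\<close>

context driftless_subordinator
begin

lemma phi_lamL_nonneg: "scaling_L \<phi> \<gamma> lamL C \<Longrightarrow> 0 \<le> \<phi> lamL"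
  using lap phi_nonneg[of lamL] by (cases "lamL = 0") (auto simp: scaling_L_def laplace_exponent_def)

text \<open>On this range |x|^2 r \<le> 1, so the Gaussian factor in the lower bound costs only
  e^(-b/4); the upper bound discards it and uses the negative moment, which covers x = 0
  too.\<close>

proposition near_diagonal_estimate:
  assumes sc: "scaling_L \<phi> \<gamma> lamL C"
  shows "\<exists>\<kappa>. 0 < \<kappa> \<and> \<kappa> < 1 \<and>
    comparable_on {(t, x :: real ^ 'd). time_range \<phi> \<kappa> lamL t \<and> ereal t * phi_at_inv_norm_sq \<phi> x \<ge> 1}
      (\<lambda>(t, x). transition_density M S t x)
      (\<lambda>(t, x). ennreal (phi_inv \<phi> (inverse t) powr (real CARD('d) / 2)))"
proof -
  define p where "p = real CARD('d) / 2"
  have p: "0 < p" by (simp add: p_def)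
  have C: "0 < C" "0 < \<gamma>" "0 \<le> lamL" and pos: "\<And>l. 0 < l \<Longrightarrow> 0 < \<phi> l" using sc by (auto simp: scaling_L_def)
  obtain b where b: "2 \<le> b" "8 \<le> C * b powr \<gamma>" using powr_large[of \<gamma> C 8] C by auto
  obtain D where D: "0 < D" "\<And>t r. 0 < t \<Longrightarrow> lamL < r \<Longrightarrow> t * \<phi> r = 1 \<Longrightarrow>
      (\<integral>\<^sup>+ \<omega>. ennreal (S t \<omega> powr (- p)) * indicator {0<..} (S t \<omega>) \<partial>M) \<le> ennreal (D * r powr p)"
    using nn_integral_powr_le[OF sc p] by blast
  define c where "c = (4 * pi * b) powr (- p) / 2 * exp (- (b / 4))"
  have c: "0 < c" using b by (simp add: c_def)
  have main: "ennreal (1 / D) * transition_density M S t x \<le> ennreal (phi_inv \<phi> (inverse t) powr p) \<and>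
      ennreal (phi_inv \<phi> (inverse t) powr p) \<le> ennreal (1 / c) * transition_density M S t x"
    if "time_range \<phi> (1 / b) lamL t" "1 \<le> ereal t * phi_at_inv_norm_sq \<phi> x" for t and x :: "real ^ 'd"
  proof -
    have t: "0 < t" "t * \<phi> lamL < 1 / b"
      using time_rangeD[OF that(1)] b phi_lamL_nonneg[OF sc] by auto
    define r where "r = phi_inv \<phi> (inverse t)"
    have r: "0 < r" "t * \<phi> r = 1" using phi_inv[OF sc, of "inverse t"] t by (auto simp: r_def)
    have "b * lamL < r" using less_of_time_bound[OF t(1) r(1) _ C(3) r(2) t(2)] b by simp
    then have rl: "lamL < r" using b C mult_right_mono[of 1 b lamL] by linarith
    note [measurable] = S_measurable[OF less_imp_le[OF t(1)]]
    define u where "u = (norm x)\<^sup>2"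
    have u: "0 \<le> u" by (simp add: u_def)
    \<comment> \<open>If u r > 1, then 1/u < r, and strict monotonicity gives t \<phi>(1/u) < t
      \<phi>(r) = 1.\<close>
    have ur: "u * r \<le> 1"
    proof (rule ccontr)
      assume *: "\<not> u * r \<le> 1"
      then have "u \<noteq> 0" by auto
      then have u0: "0 < u" "x \<noteq> 0" using u by (auto simp: u_def)
      then have "1 / u < r" using * by (simp add: field_simps)
      then have "\<phi> (1 / u) < \<phi> r" using u0 pos by (intro phi_strict_mono) auto
      moreover have "1 \<le> t * \<phi> (1 / u)"
        using that(2) u0 by (simp add: phi_at_inv_norm_sq_def u_def inverse_eq_divide)
      ultimately show False using r t mult_strict_left_mono[of "\<phi> (1 / u)" "\<phi> r" t] by linarith
    qed
    have td: "transition_density M S t x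
        = (\<integral>\<^sup>+ \<omega>. ennreal (heat_kernel p u (S t \<omega>)) * indicator {0<..} (S t \<omega>) \<partial>M)"
      using transition_density_eq[of t x] t by (simp add: p_def u_def)
    have "transition_density M S t x \<le> (\<integral>\<^sup>+ \<omega>. ennreal (S t \<omega> powr (- p)) * indicator {0<..} (S t \<omega>) \<partial>M)"
      unfolding td
    proof (rule nn_integral_mono)
      fix \<omega>
      show "ennreal (heat_kernel p u (S t \<omega>)) * indicator {0<..} (S t \<omega>)
          \<le> ennreal (S t \<omega> powr (- p)) * indicator {0<..} (S t \<omega>)"
      proof (cases "0 < S t \<omega>")
        case True
        have "heat_kernel p u (S t \<omega>) \<le> S t \<omega> powr (- p) * exp (- u / (4 * S t \<omega>))"
          using p True by (intro heat_kernel_le) auto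
        also have "\<dots> \<le> S t \<omega> powr (- p)" using u True by (intro mult_left_le) auto
        finally show ?thesis using True by (simp add: ennreal_leI)
      qed simp
    qed
    also have "\<dots> \<le> ennreal (D * r powr p)" using D(2)[OF t(1) rl r(2)] .
    finally have "ennreal (1 / D) * transition_density M S t x \<le> ennreal (1 / D) * ennreal (D * r powr p)"
      by (rule mult_left_mono) simp
    also have "\<dots> = ennreal (r powr p)" using D(1) by (simp flip: ennreal_mult)
    finally have 1: "ennreal (1 / D) * transition_density M S t x \<le> ennreal (r powr p)" .
    have "c * r powr p \<le> (4 * pi * b) powr (- p) / 2 * (r powr p * exp (- (b / 4) * u * r))"
    proof -
      have "b / 4 * (u * r) \<le> b / 4 * 1" using ur b by (intro mult_left_mono) auto
      then have "exp (- (b / 4)) \<le> exp (- (b / 4) * u * r)" by simp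
      then have "(4 * pi * b) powr (- p) / 2 * (r powr p * exp (- (b / 4)))
          \<le> (4 * pi * b) powr (- p) / 2 * (r powr p * exp (- (b / 4) * u * r))"
        by (intro mult_left_mono) auto
      then show ?thesis by (simp add: c_def mult_ac)
    qed
    then have "ennreal (c * r powr p) \<le> transition_density M S t x"
      unfolding td using gaussian_lower_bound[OF sc b t(1) r t(2) less_imp_le[OF p] u]
      by (meson ennreal_leI order_trans)
    then have "ennreal (1 / c) * ennreal (c * r powr p) \<le> ennreal (1 / c) * transition_density M S t x"
      by (rule mult_left_mono) simp
    moreover have "ennreal (1 / c) * ennreal (c * r powr p) = ennreal (r powr p)"
      using c by (simp flip: ennreal_mult)
    ultimately show ?thesis using 1 by (simp add: r_def)
  qed
  let ?A = "{(t, x :: real ^ 'd). time_range \<phi> (1 / b) lamL t \<and> ereal t * phi_at_inv_norm_sq \<phi> x \<ge> 1}"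
  let ?f = "\<lambda>(t, x :: real ^ 'd). transition_density M S t x"
  let ?g = "\<lambda>(t, x :: real ^ 'd). ennreal (phi_inv \<phi> (inverse t) powr (real CARD('d) / 2))"
  have "comparable_on ?A ?f ?g"
    unfolding comparable_on_def
  proof (rule exI[of _ "1 / D"], rule exI[of _ "1 / c"], intro conjI ballI)
    show "0 < 1 / D" "0 < 1 / c" using D(1) c by simp_all
    fix a assume "a \<in> ?A"
    then have "time_range \<phi> (1 / b) lamL (fst a)" "1 \<le> ereal (fst a) * phi_at_inv_norm_sq \<phi> (snd a)"
      by (simp_all only: mem_Collect_eq case_prod_beta)
    note m = main[OF this, unfolded p_def]
    show "ennreal (1 / D) * ?f a \<le> ?g a" "?g a \<le> ennreal (1 / c) * ?f a"
      using m by (simp_all only: case_prod_beta)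
  qed
  moreover have "0 < 1 / b" "1 / b < 1" using b by simp_all
  ultimately show ?thesis by blast
qed

proposition off_diagonal_estimate:
  assumes scL: "scaling_L H \<gamma> lamL C\<^sub>L" and scU: "scaling_U H \<delta> lamU C\<^sub>U" and \<delta>: "\<delta> < 2"
  shows "\<exists>\<kappa> \<eta> \<theta> C a\<^sub>L a\<^sub>U.
    0 < \<kappa> \<and> \<kappa> < 1 \<and> 0 < \<eta> \<and> \<eta> < 1 \<and> 0 < \<theta> \<and> \<theta> < 1 \<and> C \<ge> 1 \<and> a\<^sub>L > 0 \<and> a\<^sub>U > 0 \<and>
    (\<forall>t. \<forall>x :: real ^ 'd.
      time_range \<phi> \<kappa> lamL t \<and> space_range \<theta> lamL \<eta> lamU x \<and> ereal t * phi_at_inv_norm_sq \<phi> x \<le> 1 \<longrightarrow>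
      transition_density M S t x \<le> ennreal (C * two_term_bound \<phi> a\<^sub>U t x) \<and>
      transition_density M S t x \<ge> ennreal (inverse C * two_term_bound \<phi> a\<^sub>L t x))"
proof -
  define p where "p = real CARD('d) / 2"
  have p: "0 < p" by (simp add: p_def)
  have sc: "scaling_L \<phi> \<gamma> lamL C\<^sub>L" using scL by (rule scaling_L_phi)
  have L: "0 < C\<^sub>L" "0 < \<gamma>" "0 \<le> lamL" and H: "\<And>l. 0 < l \<Longrightarrow> 0 < H l" using scL by (auto simp: scaling_L_def)
  have U: "0 \<le> lamU" using scU by (auto simp: scaling_U_def)
  obtain b where b: "2 \<le> b" "8 \<le> C\<^sub>L * b powr \<gamma>" using powr_large[of \<gamma> C\<^sub>L 8] L by auto
  obtain D where D: "0 < D" "\<And>t r. 0 < t \<Longrightarrow> lamL < r \<Longrightarrow> t * \<phi> r = 1 \<Longrightarrow>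
      (\<integral>\<^sup>+ \<omega>. ennreal (S t \<omega> powr (- p)) * indicator {0<..} (S t \<omega>) \<partial>M) \<le> ennreal (D * r powr p)"
    using nn_integral_powr_le[OF sc p] by blast
  obtain \<beta> K c1 where \<beta>: "1 < \<beta>" and K: "1 < K" and c1: "0 < c1" and jump:
    "\<And>t u. 0 < t \<Longrightarrow> 0 < u \<Longrightarrow> t * \<phi> (1 / u) \<le> 1 \<Longrightarrow> lamL * u < 1 / \<beta> \<Longrightarrow> lamU * u < 1 / K \<Longrightarrow>
      ennreal (c1 * (t * u powr (- p) * H (1 / u)))
        \<le> (\<integral>\<^sup>+ \<omega>. ennreal (heat_kernel p u (S t \<omega>)) * indicator {0<..} (S t \<omega>) \<partial>M)"
    using jump_lower_bound[OF scL scU \<delta> less_imp_le[OF p]] by blast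
  define c2 where "c2 = (4 * pi * b) powr (- p) / 2"
  have c2: "0 < c2" using b by (simp add: c2_def)
  define E where "E = 72 * (6 + exp 6) * (4 * (p + 3)) powr (p + 3)"
  have E: "0 \<le> E" by (simp add: E_def add_nonneg_nonneg)
  \<comment> \<open>One constant large enough for all four demands: the sum D + E from above, the
    reciprocals of \<open>c1\<close> and \<open>c2\<close> from below, and C \<ge> 1. From below the
    maximum is handled by bounding each of its two terms separately.\<close>
  define C where "C = 1 + D + E + 1 / c1 + 1 / c2"
  have C: "1 \<le> C" "D + E \<le> C" "1 / c1 \<le> C" "1 / c2 \<le> C" using D(1) E c1 c2 by (auto simp: C_def)
  have invC: "0 < inverse C" "inverse C \<le> c1" "inverse C \<le> c2"
    using C c1 c2 by (auto simp: field_simps)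
  have main: "transition_density M S t x \<le> ennreal (C * two_term_bound \<phi> (1 / (12 * b)) t x) \<and>
      ennreal (inverse C * two_term_bound \<phi> (b / 4) t x) \<le> transition_density M S t x"
    if tr: "time_range \<phi> (1 / b) lamL t" and sr: "space_range (1 / sqrt \<beta>) lamL (1 / sqrt K) lamU x"
      and tx: "ereal t * phi_at_inv_norm_sq \<phi> x \<le> 1" for t and x :: "real ^ 'd"
  proof -
    have t: "0 < t" "t * \<phi> lamL < 1 / b"
      using time_rangeD[OF tr] b phi_lamL_nonneg[OF sc] by auto
    define r where "r = phi_inv \<phi> (inverse t)"
    have r: "0 < r" "t * \<phi> r = 1" using phi_inv[OF sc, of "inverse t"] t by (auto simp: r_def)
    have "b * lamL < r" using less_of_time_bound[OF t(1) r(1) _ L(3) r(2) t(2)] b by simp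
    then have rl: "lamL < r" using b L mult_right_mono[of 1 b lamL] by linarith
    have x: "x \<noteq> 0" using tx t by (auto simp: phi_at_inv_norm_sq_def)
    define u where "u = (norm x)\<^sup>2"
    have u: "0 < u" using x by (simp add: u_def)
    have tu: "t * \<phi> (1 / u) \<le> 1" using tx x by (simp add: phi_at_inv_norm_sq_def u_def inverse_eq_divide)
    have range: "lamL * u < 1 / \<beta>" "lamU * u < 1 / K"
      using space_rangeD[OF sr] \<beta> K L U by (auto simp: u_def power_divide)
    have td: "transition_density M S t x
        = (\<integral>\<^sup>+ \<omega>. ennreal (heat_kernel p u (S t \<omega>)) * indicator {0<..} (S t \<omega>) \<partial>M)"
      using transition_density_eq[of t x] t by (simp add: p_def u_def)
    define J where "J = t * u powr (- p) * H (1 / u)"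
    define G where "G a = r powr p * exp (- a * u * r)" for a
    have J: "0 \<le> J" using t u H[of "1 / u"] by (simp add: J_def)
    have G: "0 \<le> G a" for a by (simp add: G_def)
    have two: "two_term_bound \<phi> a t x = max J (G a)" for a
    proof -
      have "norm x powr (- real CARD('d)) = u powr (- p)"
        using x by (simp add: u_def p_def powr_powr flip: powr_numeral)
      then show ?thesis
        by (simp add: two_term_bound_def J_def G_def p_def u_def r_def inverse_eq_divide)
    qed
    have "transition_density M S t x \<le> ennreal (D * G (1 / (12 * b)) + E * J)"
      unfolding td using density_le[OF sc b t(1) r t(2) H p u less_imp_le[OF D(1)] D(2)[OF t(1) rl r(2)]]
      by (simp only: G_def J_def E_def)
    also have "\<dots> \<le> ennreal (C * max J (G (1 / (12 * b))))"
    proof (rule ennreal_leI)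
      let ?m = "max J (G (1 / (12 * b)))"
      have "D * G (1 / (12 * b)) + E * J \<le> D * ?m + E * ?m"
        using D(1) E by (intro add_mono mult_left_mono) auto
      also have "\<dots> = (D + E) * ?m" by (simp add: distrib_right)
      also have "\<dots> \<le> C * ?m" using C J by (intro mult_right_mono) (auto simp: le_max_iff_disj)
      finally show "D * G (1 / (12 * b)) + E * J \<le> C * ?m" .
    qed
    finally have upper: "transition_density M S t x \<le> ennreal (C * two_term_bound \<phi> (1 / (12 * b)) t x)"
      by (simp only: two)
    have "ennreal (inverse C * J) \<le> transition_density M S t x"
    proof -
      have "inverse C * J \<le> c1 * J" using invC J by (intro mult_right_mono) auto
      then show ?thesis
        using jump[OF t(1) u tu range] unfolding td J_def by (meson ennreal_leI order_trans)
    qed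
    moreover have "ennreal (inverse C * G (b / 4)) \<le> transition_density M S t x"
    proof -
      have "inverse C * G (b / 4) \<le> c2 * G (b / 4)" using invC G by (intro mult_right_mono) auto
      then show ?thesis
        using gaussian_lower_bound[OF sc b t(1) r t(2) less_imp_le[OF p] less_imp_le[OF u]]
        unfolding td G_def c2_def by (meson ennreal_leI order_trans)
    qed
    ultimately have "ennreal (inverse C * two_term_bound \<phi> (b / 4) t x) \<le> transition_density M S t x"
      unfolding two by (simp add: max_def)
    with upper show ?thesis by simp
  qed
  \<comment> \<open>The square roots in \<theta> = 1/sqrt \<beta> and \<eta> = 1/sqrt K appear
    because the jump bound restricts u = |x|^2, whereas the spatial range restricts |x|.\<close>
  have "0 < 1 / b" "1 / b < 1" "0 < 1 / sqrt K" "1 / sqrt K < 1" "0 < 1 / sqrt \<beta>" "1 / sqrt \<beta> < 1"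
      "1 \<le> C" "0 < b / 4" "0 < 1 / (12 * b)"
    using b \<beta> K C(1) by simp_all
  moreover have "\<forall>t. \<forall>x :: real ^ 'd. time_range \<phi> (1 / b) lamL t \<and> space_range (1 / sqrt \<beta>) lamL (1 / sqrt K) lamU x
      \<and> ereal t * phi_at_inv_norm_sq \<phi> x \<le> 1 \<longrightarrow>
      transition_density M S t x \<le> ennreal (C * two_term_bound \<phi> (1 / (12 * b)) t x) \<and>
      transition_density M S t x \<ge> ennreal (inverse C * two_term_bound \<phi> (b / 4) t x)"
    by (intro allI impI, elim conjE) (rule main)
  ultimately show ?thesis
    by - (rule exI[of _ "1 / b"], rule exI[of _ "1 / sqrt K"], rule exI[of _ "1 / sqrt \<beta>"],
        rule exI[of _ C], rule exI[of _ "b / 4"], rule exI[of _ "1 / (12 * b)"], intro conjI)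
qed

end

theorem theorem1p2:
  fixes M :: "'w measure"
    and S :: "real \<Rightarrow> 'w \<Rightarrow> real"
    and B X :: "real \<Rightarrow> 'w \<Rightarrow> real ^ 'd"
    and \<phi> :: "real \<Rightarrow> real"
    and \<mu> :: "real measure"
  assumes "subordinator M S"
    and "laplace_exponent M S \<phi>"
    and "has_drift_and_levy_measure \<phi> 0 \<mu>"
    and "subordinate_brownian_motion M B S X"
  shows
    "(\<forall>\<gamma> lamL C\<^sub>L. scaling_L \<phi> \<gamma> lamL C\<^sub>L \<longrightarrow>
        (\<exists>\<kappa>. 0 < \<kappa> \<and> \<kappa> < 1 \<and>
           comparable_on {(t, x :: real ^ 'd). time_range \<phi> \<kappa> lamL t \<and> ereal t * phi_at_inv_norm_sq \<phi> x \<ge> 1}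
             (\<lambda>(t, x). transition_density M S t x)
             (\<lambda>(t, x). ennreal (phi_inv \<phi> (inverse t) powr (real CARD('d) / 2)))))
     \<and>
     (\<forall>\<gamma> lamL C\<^sub>L \<delta> lamU C\<^sub>U.
        scaling_L (H_of \<phi>) \<gamma> lamL C\<^sub>L \<and> scaling_U (H_of \<phi>) \<delta> lamU C\<^sub>U \<and> \<delta> < 2 \<longrightarrow>
        (\<exists>\<kappa> \<eta> \<theta> C a\<^sub>L a\<^sub>U.
           0 < \<kappa> \<and> \<kappa> < 1 \<and> 0 < \<eta> \<and> \<eta> < 1 \<and> 0 < \<theta> \<and> \<theta> < 1 \<and> C \<ge> 1 \<and> a\<^sub>L > 0 \<and> a\<^sub>U > 0 \<and>
           (\<forall>t. \<forall>x :: real ^ 'd.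
              time_range \<phi> \<kappa> lamL t \<and> space_range \<theta> lamL \<eta> lamU x \<and> ereal t * phi_at_inv_norm_sq \<phi> x \<le> 1 \<longrightarrow>
              transition_density M S t x \<le> ennreal (C * two_term_bound \<phi> a\<^sub>U t x) \<and>
              transition_density M S t x \<ge> ennreal (inverse C * two_term_bound \<phi> a\<^sub>L t x))))"
proof -
  interpret driftless_subordinator M S \<phi> \<mu>
    by unfold_locales (fact assms)+
  show ?thesis
    using near_diagonal_estimate off_diagonal_estimate by blast
qed

end
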